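(* Let $G \in \mathscr{S}$. Assume that $G$ is compactly presented. If $G$ is abstractly perfect (i.e. $G = [G,G]$), or if some compact open subgroup $U$ of $G$ is such that $U/\overline{[U,U]}$ is finite, then $\mathcal{LN}(G)^G = \{0, \infty\}$.
   Context: $\mathscr{S}$ is the class of non-discrete, compactly generated, topologically simple, totally disconnected locally compact groups (topologically simple: non-trivial, and the only closed normal subgroups are $\{1\}$ and the whole group). A locally compact group $G$ is compactly presented if there is a surjective homomorphism $\theta \colon F_X \to G$, where $F_X$ is the abstract free group on a set $X$, such that $\theta(X)$ is compact in $G$ and the kernel of $\theta$ is generated (as a normal subgroup) by words in the alphabet $X \cup X^{-1}$ of bounded length. A subgroup of $G$ is locally normal if its normaliser in $G$ is open. The structure lattice $\mathcal{LN}(G)$ is the set of closed locally normal subgroups of $G$ modulo $H \sim K$ iff $H \cap K$ is open in both $H$ and $K$; the class of $H$ is $[H]$; $0$ is the class of $\{1\}$ and $\infty$ the class of compact open subgroups. $G$ acts by conjugation, $g[H] = [gHg^{-1}]$, and $\mathcal{LN}(G)^G$ is the set of fixed points. *)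

theory Defs
  imports
    "HOL-Analysis.Analysis"
    "HOL-Algebra.Generated_Groups"
    "HOL-Algebra.Group_Action"
begin

section \<open>Topological groups\<close>

locale topological_group = group G for G :: "('a, 'b) monoid_scheme" (structure) +
  fixes T :: "'a topology"
  assumes topspace_eq: "topspace T = carrier G"
    and continuous_mult: "continuous_map (prod_topology T T) T (\<lambda>(x, y). x \<otimes> y)"
    and continuous_inv: "continuous_map T T (\<lambda>x. inv x)"

text \<open>Locally compact groups are Hausdorff by convention.\<close>

locale tdlc_group = topological_group +
  assumes Hausdorff: "Hausdorff_space T"
    and locally_compact: "locally_compact_space T"
    and totally_disconnected: "\<And>C. connectedin T C \<Longrightarrow> \<exists>x. C \<subseteq> {x}"

definition compactly_generated :: "('a, 'b) monoid_scheme \<Rightarrow> 'a topology \<Rightarrow> bool" where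
  "compactly_generated G T \<longleftrightarrow> (\<exists>K. compactin T K \<and> generate G K = carrier G)"

definition topologically_simple :: "('a, 'b) monoid_scheme \<Rightarrow> 'a topology \<Rightarrow> bool" where
  "topologically_simple G T \<longleftrightarrow>
     carrier G \<noteq> {\<one>\<^bsub>G\<^esub>} \<and>
     (\<forall>N. N \<lhd> G \<and> closedin T N \<longrightarrow> N = {\<one>\<^bsub>G\<^esub>} \<or> N = carrier G)"

definition class_S :: "('a, 'b) monoid_scheme \<Rightarrow> 'a topology \<Rightarrow> bool" where
  "class_S G T \<longleftrightarrow>
     tdlc_group G T \<and> T \<noteq> discrete_topology (carrier G) \<and>
     compactly_generated G T \<and> topologically_simple G T"

definition compact_open_subgroup ::
    "('a, 'b) monoid_scheme \<Rightarrow> 'a topology \<Rightarrow> 'a set \<Rightarrow> bool" where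
  "compact_open_subgroup G T U \<longleftrightarrow> subgroup U G \<and> compactin T U \<and> openin T U"


section \<open>Free groups\<close>

text \<open>
  The free group on \<open>X\<close> consists of the reduced words in the letters \<open>(x, True)\<close>, standing for
  \<open>x\<close>, and \<open>(x, False)\<close>, standing for the inverse of \<open>x\<close>.  In particular \<open>length w\<close> is the word
  length of an element \<open>w\<close>.
\<close>

definition inv_letter :: "'x \<times> bool \<Rightarrow> 'x \<times> bool" where
  "inv_letter a = (fst a, \<not> snd a)"

definition reduced :: "('x \<times> bool) list \<Rightarrow> bool" where
  "reduced w \<longleftrightarrow> successively (\<lambda>a b. b \<noteq> inv_letter a) w"

text \<open>Left multiplication of a reduced word by a letter, cancelling if necessary.\<close>

definition cons_letter :: "'x \<times> bool \<Rightarrow> ('x \<times> bool) list \<Rightarrow> ('x \<times> bool) list" where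
  "cons_letter a w =
     (case w of [] \<Rightarrow> [a] | b # v \<Rightarrow> if b = inv_letter a then v else a # w)"

definition free_group :: "'x set \<Rightarrow> ('x \<times> bool) list monoid" where
  "free_group X =
     \<lparr>carrier = {w \<in> lists (X \<times> UNIV). reduced w},
      monoid.mult = foldr cons_letter,
      one = []\<rparr>"

definition free_gen :: "'x \<Rightarrow> ('x \<times> bool) list" where
  "free_gen x = [(x, True)]"

lemma inv_letter_inv_letter [simp]: "inv_letter (inv_letter a) = a"
  by (simp add: inv_letter_def)

lemma inv_letter_in_iff [simp]: "inv_letter a \<in> X \<times> UNIV \<longleftrightarrow> a \<in> X \<times> UNIV"
  by (cases a) (simp add: inv_letter_def)

lemma reduced_Cons: "reduced (a # w) \<Longrightarrow> reduced w"
  by (cases w) (auto simp: reduced_def)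

lemma reduced_cons_letter: "reduced w \<Longrightarrow> reduced (cons_letter a w)"
  by (cases w) (auto simp: reduced_def cons_letter_def successively_Cons)

lemma cons_letter_in_lists:
  "a \<in> Y \<Longrightarrow> w \<in> lists Y \<Longrightarrow> cons_letter a w \<in> lists Y"
  by (cases w) (auto simp: cons_letter_def)

lemma cons_letter_inverse: "reduced w \<Longrightarrow> cons_letter a (cons_letter (inv_letter a) w) = w"
  by (cases w; cases "tl w") (auto simp: cons_letter_def reduced_def)

lemma foldr_cons_letter_in_lists:
  "u \<in> lists Y \<Longrightarrow> v \<in> lists Y \<Longrightarrow> foldr cons_letter u v \<in> lists Y"
  by (induction u) (simp_all add: cons_letter_in_lists del: in_lists_conv_set)

lemma reduced_foldr_cons_letter: "reduced v \<Longrightarrow> reduced (foldr cons_letter u v)"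
  by (induction u) (auto intro: reduced_cons_letter)

lemma foldr_cons_letter_cons_letter:
  assumes "reduced w"
  shows "foldr cons_letter (cons_letter a t) w = cons_letter a (foldr cons_letter t w)"
proof (cases t)
  case (Cons b t')
  then show ?thesis
    using cons_letter_inverse[OF reduced_foldr_cons_letter[OF assms, of t'], of a]
    by (simp add: cons_letter_def[of a "b # t'"])
qed (simp add: cons_letter_def[of a "[]"])

lemma foldr_cons_letter_assoc:
  assumes "reduced w"
  shows "foldr cons_letter (foldr cons_letter u v) w = foldr cons_letter u (foldr cons_letter v w)"
  by (induction u) (simp_all add: foldr_cons_letter_cons_letter assms)

lemma foldr_cons_letter_Nil: "reduced u \<Longrightarrow> foldr cons_letter u [] = u"
proof (induction u)
  case (Cons a u)
  then show ?case
    using reduced_Cons[OF Cons.prems]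
    by (cases u) (auto simp: cons_letter_def reduced_def)
qed simp

lemma foldr_cons_letter_inv: "foldr cons_letter (rev (map inv_letter u)) u = []"
  by (induction u) (simp_all add: cons_letter_def)

lemma reduced_inv: "reduced u \<Longrightarrow> reduced (rev (map inv_letter u))"
  by (auto simp: reduced_def successively_map elim!: successively_mono)

lemma group_free_group: "group (free_group X)"
proof (rule groupI)
  fix u assume u: "u \<in> carrier (free_group X)"
  have "rev (map inv_letter u) \<in> lists (X \<times> UNIV)"
    using u by (auto simp: free_group_def inv_letter_def lists_eq_set)
  with u show "\<exists>v\<in>carrier (free_group X). v \<otimes>\<^bsub>free_group X\<^esub> u = \<one>\<^bsub>free_group X\<^esub>"
    by (intro bexI[of _ "rev (map inv_letter u)"])
      (simp_all add: free_group_def foldr_cons_letter_inv reduced_inv)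
next
  fix u v assume "u \<in> carrier (free_group X)" "v \<in> carrier (free_group X)"
  then show "u \<otimes>\<^bsub>free_group X\<^esub> v \<in> carrier (free_group X)"
    by (simp add: free_group_def foldr_cons_letter_in_lists reduced_foldr_cons_letter
        del: in_lists_conv_set)
qed (simp_all add: free_group_def foldr_cons_letter_assoc, simp add: reduced_def)


section \<open>Compact presentations\<close>

text \<open>
  The type argument is the type over which the generating set ranges; a statement that is
  polymorphic in it therefore covers arbitrary generating sets.  The normal closure of the set
  \<open>R\<close> of relators is the least normal subgroup containing it; \<open>n\<close> bounds the lengths of the relators.
\<close>

definition compactly_presented ::
    "'x itself \<Rightarrow> ('a, 'b) monoid_scheme \<Rightarrow> 'a topology \<Rightarrow> bool" where
  "compactly_presented _ G T \<longleftrightarrow>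
     (\<exists>(X :: 'x set) \<theta> R n.
        \<theta> \<in> epi (free_group X) G \<and>
        compactin T (\<theta> ` free_gen ` X) \<and>
        R \<subseteq> carrier (free_group X) \<and> (\<forall>r\<in>R. length r \<le> n) \<and>
        kernel (free_group X) G \<theta> = (\<lambda>N. N \<lhd> free_group X) hull R)"


section \<open>The structure lattice\<close>

definition conj_set :: "('a, 'b) monoid_scheme \<Rightarrow> 'a \<Rightarrow> 'a set \<Rightarrow> 'a set" where
  "conj_set G g H = (g <#\<^bsub>G\<^esub> H) #>\<^bsub>G\<^esub> inv\<^bsub>G\<^esub> g"

definition locally_normal :: "('a, 'b) monoid_scheme \<Rightarrow> 'a topology \<Rightarrow> 'a set \<Rightarrow> bool" where
  "locally_normal G T H \<longleftrightarrow> subgroup H G \<and> openin T (normalizer G H)"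

definition closed_locally_normal ::
    "('a, 'b) monoid_scheme \<Rightarrow> 'a topology \<Rightarrow> 'a set set" where
  "closed_locally_normal G T = {H. locally_normal G T H \<and> closedin T H}"

definition loc_equiv :: "('a, 'b) monoid_scheme \<Rightarrow> 'a topology \<Rightarrow> 'a set rel" where
  "loc_equiv G T =
     {(H, K). H \<in> closed_locally_normal G T \<and> K \<in> closed_locally_normal G T \<and>
        openin (subtopology T H) (H \<inter> K) \<and> openin (subtopology T K) (H \<inter> K)}"

definition structure_lattice ::
    "('a, 'b) monoid_scheme \<Rightarrow> 'a topology \<Rightarrow> 'a set set set" where
  "structure_lattice G T = closed_locally_normal G T // loc_equiv G T"

definition LN_zero :: "('a, 'b) monoid_scheme \<Rightarrow> 'a topology \<Rightarrow> 'a set set" where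
  "LN_zero G T = loc_equiv G T `` {{\<one>\<^bsub>G\<^esub>}}"

text \<open>All compact open subgroups lie in a single class; this is the union of their classes.\<close>

definition LN_infty :: "('a, 'b) monoid_scheme \<Rightarrow> 'a topology \<Rightarrow> 'a set set" where
  "LN_infty G T = loc_equiv G T `` {U. compact_open_subgroup G T U}"

text \<open>The action \<open>g[H] = [gHg\<^sup>-\<^sup>1]\<close>, lifted to classes.\<close>

definition LN_action ::
    "('a, 'b) monoid_scheme \<Rightarrow> 'a topology \<Rightarrow> 'a \<Rightarrow> 'a set set \<Rightarrow> 'a set set" where
  "LN_action G T g c = (\<Union>H\<in>c. loc_equiv G T `` {conj_set G g H})"

definition LN_fixed :: "('a, 'b) monoid_scheme \<Rightarrow> 'a topology \<Rightarrow> 'a set set set" where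
  "LN_fixed G T = {c \<in> structure_lattice G T. \<forall>g\<in>carrier G. LN_action G T g c = c}"

end

theory Submission
  imports Defs "HOL-Algebra.Multiplicative_Group"
begin

text \<open>
  A non-zero fixed class is represented by a closed normal subgroup \<open>H \<noteq> 1\<close> of a compact open
  subgroup \<open>U\<close>, commensurated by \<open>G\<close>.  The elements acting trivially on the germ of \<open>U / H\<close> at the
  identity form a normal subgroup \<open>K \<supseteq> H\<close>, which is dense by simplicity.  So every letter of
  the presentation is a product of one of finitely many elements of \<open>K\<close> and an element of \<open>U\<close>.
  The \<open>U\<close>-conjugates of those elements of \<open>K\<close> generate, together with \<open>H\<close>, a dense normal subgroup
  \<open>M\<close> that is a countable union of cosets of \<open>H\<close>, and the second factors define a homomorphism \<open>\<psi>\<close>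
  from the free group to \<open>U\<close> which agrees with the presentation modulo \<open>M\<close>.  Short relators are
  mapped by \<open>\<psi>\<close> into finitely many cosets of \<open>H\<close> in \<open>K \<inter> U\<close>, so an open subgroup \<open>V\<close> of \<open>U\<close>
  centralises them modulo \<open>H\<close>; compact presentability extends this to all relators, hence to
  \<open>M \<inter> U\<close>, and density of \<open>M\<close> makes \<open>V\<close> central in \<open>U\<close> modulo \<open>H\<close>.

  In particular \<open>G / M\<close> is abelian: if \<open>G\<close> is perfect, then \<open>G = M\<close> is a countable union of cosets
  of \<open>H\<close> and \<open>H\<close> is open by Baire's theorem.  If \<open>U\<close> has finite abelianization, then Schur's theorem
  on the central-by-finite group \<open>U / H\<close> shows that \<open>H\<close> has finite index in \<open>U\<close>.
\<close>

section \<open>Powers of subsets and finiteness modulo a subgroup\<close>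

context group
begin

lemma inv_mult_cancel_left [simp]:
  "x \<in> carrier G \<Longrightarrow> y \<in> carrier G \<Longrightarrow> inv x \<otimes> (x \<otimes> y) = y"
  by (simp flip: m_assoc)

lemma mult_inv_cancel_left [simp]:
  "x \<in> carrier G \<Longrightarrow> y \<in> carrier G \<Longrightarrow> x \<otimes> (inv x \<otimes> y) = y"
  by (simp flip: m_assoc)

lemma set_mult_closed_subset: "A \<subseteq> carrier G \<Longrightarrow> B \<subseteq> carrier G \<Longrightarrow> A <#> B \<subseteq> carrier G"
  by (auto simp: set_mult_def)

end

text \<open>Products of exactly \<open>k\<close> factors; these sets need not increase with
  \<open>k\<close> unless \<open>\<one> \<in> S\<close>. The exact count is kept because it is
  matched with word lengths later.\<close>

definition set_power :: "('a, 'b) monoid_scheme \<Rightarrow> 'a set \<Rightarrow> nat \<Rightarrow> 'a set" where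
  "set_power G S k = ((<#>\<^bsub>G\<^esub>) S ^^ k) {\<one>\<^bsub>G\<^esub>}"

lemma set_power_0 [simp]: "set_power G S 0 = {\<one>\<^bsub>G\<^esub>}"
  and set_power_Suc [simp]: "set_power G S (Suc k) = S <#>\<^bsub>G\<^esub> set_power G S k"
  by (simp_all add: set_power_def)

context group
begin

lemma set_mult_memI: "a \<in> A \<Longrightarrow> b \<in> B \<Longrightarrow> a \<otimes> b \<in> A <#> B"
  by (auto simp: set_mult_def)

lemma set_mult_memE:
  assumes "x \<in> A <#> B"
  obtains a b where "a \<in> A" "b \<in> B" "x = a \<otimes> b"
  using assms by (auto simp: set_mult_def)

lemma set_power_closed: "S \<subseteq> carrier G \<Longrightarrow> set_power G S k \<subseteq> carrier G"
  by (induction k) (simp_all add: set_mult_closed_subset)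

lemma set_power_subset_subgroup:
  "subgroup K G \<Longrightarrow> S \<subseteq> K \<Longrightarrow> set_power G S k \<subseteq> K"
  by (induction k) (auto simp: subgroup.one_closed set_mult_def intro: subgroup.m_closed)

lemma set_power_add:
  assumes "S \<subseteq> carrier G" "x \<in> set_power G S k" "y \<in> set_power G S l"
  shows "x \<otimes> y \<in> set_power G S (k + l)"
  using assms(2)
proof (induction k arbitrary: x)
  case 0
  then show ?case
    using assms(3) set_power_closed[OF assms(1), of l] by auto
next
  case (Suc k)
  then obtain a b where ab: "a \<in> S" "b \<in> set_power G S k" "x = a \<otimes> b"
    by (auto elim: set_mult_memE)
  then have "x \<otimes> y = a \<otimes> (b \<otimes> y)"
    using assms(1,3) set_power_closed[OF assms(1)] by (auto intro!: m_assoc)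
  then show ?case
    using Suc.IH[OF ab(2)] ab(1) by (auto intro: set_mult_memI)
qed

text \<open>Shorter products are padded with factors \<open>\<one>\<close>.\<close>

lemma set_power_mono:
  assumes "S \<subseteq> carrier G" "\<one> \<in> S" "k \<le> l"
  shows "set_power G S k \<subseteq> set_power G S l"
proof -
  have one: "\<one> \<in> set_power G S j" for j
    by (induction j) (use assms(2) set_mult_memI[of \<one> S \<one>] in auto)
  have "x \<otimes> \<one> \<in> set_power G S (k + (l - k))" if "x \<in> set_power G S k" for x
    using set_power_add[OF assms(1) that one] .
  then show ?thesis
    using assms set_power_closed[OF assms(1)] by (force simp: subset_iff)
qed

lemma set_power_conj:
  assumes S: "S \<subseteq> carrier G" and u: "u \<in> carrier G"
    and inv: "\<And>s. s \<in> S \<Longrightarrow> u \<otimes> s \<otimes> inv u \<in> S"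
    and x: "x \<in> set_power G S k"
  shows "u \<otimes> x \<otimes> inv u \<in> set_power G S k"
  using x
proof (induction k arbitrary: x)
  case (Suc k)
  then obtain a b where ab: "a \<in> S" "b \<in> set_power G S k" "x = a \<otimes> b"
    by (auto elim: set_mult_memE)
  then have "a \<in> carrier G" "b \<in> carrier G"
    using S set_power_closed[OF S] by auto
  then have "u \<otimes> x \<otimes> inv u = (u \<otimes> a \<otimes> inv u) \<otimes> (u \<otimes> b \<otimes> inv u)"
    using u ab by (simp add: m_assoc)
  then show ?case
    using Suc.IH[OF ab(2)] inv[OF ab(1)] by (auto intro: set_mult_memI)
qed (use u in simp)

lemma generate_eq_Union_set_power:
  assumes S: "S \<subseteq> carrier G" and sym: "\<And>s. s \<in> S \<Longrightarrow> inv s \<in> S"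
  shows "generate G S = (\<Union>k. set_power G S k)"
proof
  show "generate G S \<subseteq> (\<Union>k. set_power G S k)"
  proof
    fix x assume "x \<in> generate G S"
    then show "x \<in> (\<Union>k. set_power G S k)"
    proof induction
      case one
      show ?case by (auto intro!: exI[of _ 0])
    next
      case (incl h)
      then have "h \<otimes> \<one> \<in> set_power G S 1" "h \<in> carrier G"
        using S by (auto intro: set_mult_memI)
      then show ?case by (auto simp: r_one intro!: exI[of _ "Suc 0"])
    next
      case (inv h)
      then have "inv h \<otimes> \<one> \<in> set_power G S 1" "h \<in> carrier G"
        using S sym by (auto intro: set_mult_memI)
      then show ?case by (auto intro!: exI[of _ "Suc 0"])
    next
      case (eng h1 h2)
      then show ?case using set_power_add[OF S] by blast
    qed
  qed
  show "(\<Union>k. set_power G S k) \<subseteq> generate G S"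
    using set_power_subset_subgroup[OF generate_is_subgroup[OF S]] generate.incl[of _ S G] by blast
qed

lemma normal_preimage:
  assumes N: "N \<lhd> G" and h: "group_hom F G h"
  shows "{x \<in> carrier F. h x \<in> N} \<lhd> F"
proof -
  interpret group_hom F G h by fact
  interpret N: normal N G by fact
  show ?thesis
    by (rule group.normal_invI, simp, unfold_locales) (auto simp: N.inv_op_closed2)
qed

text \<open>Meant for sets that need not be unions of cosets and for \<open>H\<close> that need not
  be normal. The representatives may lie outside \<open>A\<close>.\<close>

definition finite_mod :: "'a set \<Rightarrow> 'a set \<Rightarrow> bool" where
  "finite_mod H A \<longleftrightarrow> (\<exists>F. finite F \<and> F \<subseteq> carrier G \<and> A \<subseteq> H <#> F)"

lemma finite_mod_subset: "finite_mod H B \<Longrightarrow> A \<subseteq> B \<Longrightarrow> finite_mod H A"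
  unfolding finite_mod_def by blast

lemma finite_mod_UN:
  assumes "finite I" "\<And>i. i \<in> I \<Longrightarrow> finite_mod H (A i)"
  shows "finite_mod H (\<Union>i\<in>I. A i)"
proof -
  obtain F where F: "\<And>i. i \<in> I \<Longrightarrow> finite (F i) \<and> F i \<subseteq> carrier G \<and> A i \<subseteq> H <#> F i"
    using assms(2) unfolding finite_mod_def by metis
  then have "finite (\<Union>i\<in>I. F i) \<and> (\<Union>i\<in>I. F i) \<subseteq> carrier G \<and>
      (\<Union>i\<in>I. A i) \<subseteq> H <#> (\<Union>i\<in>I. F i)"
    using assms(1) by (fastforce simp: set_mult_def)
  then show ?thesis unfolding finite_mod_def by blast
qed

lemma finite_mod_Un: "finite_mod H A \<Longrightarrow> finite_mod H B \<Longrightarrow> finite_mod H (A \<union> B)"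
  using finite_mod_UN[of "{A, B}" H id] by auto

text \<open>Commensuration allows \<open>H\<close> to be moved past a representative:
  \<open>h e h' f = h (e h' e^-1) e f\<close>, and \<open>e H e^-1\<close> is covered by finitely
  many cosets \<open>H d\<close>.\<close>

lemma finite_mod_mult:
  assumes H: "subgroup H G" and comm: "\<And>g. g \<in> carrier G \<Longrightarrow> finite_mod H (conj_set G g H)"
    and A: "finite_mod H A" and B: "finite_mod H B"
  shows "finite_mod H (A <#> B)"
proof -
  interpret H: subgroup H G by fact
  obtain E F where E: "finite E" "E \<subseteq> carrier G" "A \<subseteq> H <#> E"
    and F: "finite F" "F \<subseteq> carrier G" "B \<subseteq> H <#> F"
    using A B unfolding finite_mod_def by blast
  obtain D where D: "\<And>g. g \<in> carrier G \<Longrightarrow>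
      finite (D g) \<and> D g \<subseteq> carrier G \<and> conj_set G g H \<subseteq> H <#> D g"
    using comm unfolding finite_mod_def by metis
  let ?F = "(\<Union>e\<in>E. \<Union>f\<in>F. (\<lambda>d. d \<otimes> e \<otimes> f) ` D e)"
  have "A <#> B \<subseteq> H <#> ?F"
  proof
    fix x assume "x \<in> A <#> B"
    then obtain a b where "a \<in> A" "b \<in> B" "x = a \<otimes> b"
      by (rule set_mult_memE)
    with E F obtain h e h' f where hf: "h \<in> H" "e \<in> E" "h' \<in> H" "f \<in> F"
      "x = (h \<otimes> e) \<otimes> (h' \<otimes> f)"
      by (blast elim!: set_mult_memE dest!: subsetD)
    have car: "h \<in> carrier G" "e \<in> carrier G" "h' \<in> carrier G" "f \<in> carrier G"
      using hf E F by auto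
    have "e \<otimes> h' \<otimes> inv e \<in> conj_set G e H"
      using hf(3) by (auto simp: conj_set_def l_coset_def r_coset_def)
    then obtain k d where kd: "k \<in> H" "d \<in> D e" "e \<otimes> h' \<otimes> inv e = k \<otimes> d"
      using D[OF car(2)] by (blast elim!: set_mult_memE dest!: subsetD)
    have d: "d \<in> carrier G" "k \<in> carrier G" using D[OF car(2)] kd by auto
    have "x = h \<otimes> (e \<otimes> h' \<otimes> inv e) \<otimes> e \<otimes> f"
      using hf(5) car by (simp add: m_assoc)
    also have "\<dots> = (h \<otimes> k) \<otimes> (d \<otimes> e \<otimes> f)"
      unfolding kd(3) using car d by (simp add: m_assoc)
    finally show "x \<in> H <#> ?F"
      using hf kd by (auto intro!: set_mult_memI)
  qed
  moreover have "finite ?F" "?F \<subseteq> carrier G"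
    using E F D by (auto intro!: finite_UN_I m_closed) (blast dest: D)+
  ultimately show ?thesis unfolding finite_mod_def by blast
qed

lemma finite_mod_set_power:
  assumes H: "subgroup H G" and comm: "\<And>g. g \<in> carrier G \<Longrightarrow> finite_mod H (conj_set G g H)"
    and S: "finite_mod H S"
  shows "finite_mod H (set_power G S k)"
proof (induction k)
  case 0
  then show ?case
    using subgroup.one_closed[OF H] unfolding finite_mod_def
    by (auto intro!: exI[of _ "{\<one>}"] bexI[of _ \<one>] simp: set_mult_def)
qed (simp add: finite_mod_mult[OF H comm S])

end

section \<open>Topological groups\<close>

text \<open>Compactness yields finitely many open sets; this version yields finitely many centres,
  which later serve as coset representatives.\<close>

lemma compactin_finite_cover:
  assumes A: "compactin X A" and B: "\<And>c. c \<in> A \<Longrightarrow> openin X (B c) \<and> c \<in> B c"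
  obtains F where "finite F" "F \<subseteq> A" "A \<subseteq> (\<Union>c\<in>F. B c)"
proof -
  have "\<forall>U\<in>B ` A. openin X U" "A \<subseteq> \<Union>(B ` A)" using B by auto
  then obtain \<F> where "finite \<F>" "\<F> \<subseteq> B ` A" "A \<subseteq> \<Union>\<F>"
    using A unfolding compactin_def by meson
  then show thesis using finite_subset_image[of \<F> B A] that by metis
qed

section \<open>Continuity, compactness and open subgroups in topological groups\<close>

context topological_group
begin

lemma topspace [simp]: "topspace T = carrier G"
  by (rule topspace_eq)

lemma openin_carrierD: "openin T A \<Longrightarrow> A \<subseteq> carrier G"
  using openin_subset by force

lemma compactin_carrierD: "compactin T A \<Longrightarrow> A \<subseteq> carrier G"
  using compactin_subset_topspace by force

lemma continuous_map_mult:
  assumes "continuous_map X T f" "continuous_map X T g"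
  shows "continuous_map X T (\<lambda>x. f x \<otimes> g x)"
  using continuous_map_compose[OF continuous_map_pairedI[OF assms] continuous_mult]
  by (simp add: o_def)

lemma continuous_map_inv:
  assumes "continuous_map X T f"
  shows "continuous_map X T (\<lambda>x. inv (f x))"
  using continuous_map_compose[OF assms continuous_inv] by (simp add: o_def)

lemma continuous_map_carrier_const: "c \<in> carrier G \<Longrightarrow> continuous_map X T (\<lambda>x. c)"
  by simp

lemmas continuous_map_group_intros =
  continuous_map_mult continuous_map_inv continuous_map_carrier_const continuous_map_id[unfolded id_def]

lemma openin_preimage:
  "continuous_map T T f \<Longrightarrow> openin T O' \<Longrightarrow> openin T {x \<in> carrier G. f x \<in> O'}"
  using openin_continuous_map_preimage[of T T f O'] by simp

lemma closedin_preimage: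
  "continuous_map T T f \<Longrightarrow> closedin T C \<Longrightarrow> closedin T {x \<in> carrier G. f x \<in> C}"
  using closedin_continuous_map_preimage[of T T f C] by simp

lemma compactin_image: "continuous_map T T f \<Longrightarrow> compactin T C \<Longrightarrow> compactin T (f ` C)"
  by (rule image_compactin)

lemma compactin_set_mult:
  assumes "compactin T A" "compactin T B"
  shows "compactin T (A <#> B)"
proof -
  have "A <#> B = (\<lambda>(x, y). x \<otimes> y) ` (A \<times> B)"
    by (auto simp: set_mult_def)
  moreover have "compactin (prod_topology T T) (A \<times> B)"
    using assms by (simp add: compactin_Times)
  ultimately show ?thesis
    using image_compactin continuous_mult by metis
qed

lemma compactin_set_power: "compactin T A \<Longrightarrow> compactin T (set_power G A k)"
  by (induction k) (simp_all add: compactin_set_mult)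

text \<open>The translates \<open>h A\<close> with \<open>h\<close> in \<open>H\<close> stay inside
  \<open>H\<close> and cover it.\<close>

lemma openin_subgroupI:
  assumes "subgroup H G" "openin T A" "\<one> \<in> A" "A \<subseteq> H"
  shows "openin T H"
proof (subst openin_subopen, intro ballI)
  interpret subgroup H G by fact
  fix h assume h: "h \<in> H"
  let ?A = "{x \<in> carrier G. inv h \<otimes> x \<in> A}"
  have "openin T ?A"
    using h assms(2) by (intro openin_preimage continuous_map_group_intros) auto
  moreover have "h \<in> ?A" using h assms(3) by simp
  moreover have "x \<in> H" if "x \<in> ?A" for x
  proof -
    have "h \<otimes> (inv h \<otimes> x) \<in> H" using that h assms(4) by blast
    then show ?thesis using that h by simp
  qed
  ultimately show "\<exists>A. openin T A \<and> h \<in> A \<and> A \<subseteq> H" by blast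
qed

text \<open>The complement is a union of left cosets, which are open.\<close>

lemma closedin_open_subgroup:
  assumes "subgroup H G" "openin T H"
  shows "closedin T H"
  unfolding closedin_def
proof
  interpret subgroup H G by fact
  show "openin T (topspace T - H)"
  proof (subst openin_subopen, intro ballI)
    fix g assume g: "g \<in> topspace T - H"
    let ?A = "{x \<in> carrier G. inv g \<otimes> x \<in> H}"
    have "openin T ?A"
      using g assms(2) by (intro openin_preimage continuous_map_group_intros) auto
    moreover have "g \<in> ?A" using g by simp
    moreover have "?A \<subseteq> topspace T - H"
    proof
      fix x assume x: "x \<in> ?A"
      have "x \<notin> H"
      proof
        assume "x \<in> H"
        then have "x \<otimes> inv (inv g \<otimes> x) \<in> H" using x by blast
        moreover have "x \<otimes> inv (inv g \<otimes> x) = g" using x g by (simp add: inv_mult_group)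
        ultimately show False using g by simp
      qed
      then show "x \<in> topspace T - H" using x by simp
    qed
    ultimately show "\<exists>A. openin T A \<and> g \<in> A \<and> A \<subseteq> topspace T - H"
      by (intro exI[of _ ?A] conjI)
  qed
qed (use assms(1) in \<open>simp add: subgroup.subset\<close>)

lemma closedin_translate:
  assumes "closedin T H" "H \<subseteq> carrier G" "g \<in> carrier G"
  shows "closedin T (H #> g)"
proof -
  have "H #> g = {x \<in> carrier G. x \<otimes> inv g \<in> H}"
  proof (intro equalityI subsetI)
    fix x assume x: "x \<in> {x \<in> carrier G. x \<otimes> inv g \<in> H}"
    then have "x = (x \<otimes> inv g) \<otimes> g" using assms(3) by (simp add: m_assoc)
    then show "x \<in> H #> g" using x by (auto simp: r_coset_def)
  qed (use assms in \<open>auto simp: r_coset_def m_assoc subset_iff\<close>)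
  then show ?thesis
    using assms(3) by (auto intro!: closedin_preimage continuous_map_group_intros assms(1))
qed

lemma finite_right_cover:
  assumes A: "compactin T A" and O: "openin T O'" "\<one> \<in> O'"
  obtains F where "finite F" "F \<subseteq> A" "\<And>x. x \<in> A \<Longrightarrow> \<exists>c\<in>F. x \<otimes> inv c \<in> O'"
proof -
  obtain F where "finite F" "F \<subseteq> A" and F: "A \<subseteq> (\<Union>c\<in>F. {x \<in> carrier G. x \<otimes> inv c \<in> O'})"
  proof (rule compactin_finite_cover[OF A])
    fix c assume "c \<in> A"
    then have "c \<in> carrier G" using compactin_carrierD[OF A] by blast
    then show "openin T {x \<in> carrier G. x \<otimes> inv c \<in> O'} \<and> c \<in> {x \<in> carrier G. x \<otimes> inv c \<in> O'}"
      using O by (auto intro!: openin_preimage continuous_map_group_intros)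
  qed
  show thesis
  proof (rule that)
    show "\<exists>c\<in>F. x \<otimes> inv c \<in> O'" if "x \<in> A" for x
      using subsetD[OF F that] by simp
  qed fact+
qed

lemma finite_left_cover:
  assumes A: "compactin T A" and O: "openin T O'" "\<one> \<in> O'"
  obtains F where "finite F" "F \<subseteq> A" "\<And>x. x \<in> A \<Longrightarrow> \<exists>c\<in>F. inv c \<otimes> x \<in> O'"
proof -
  obtain F where "finite F" "F \<subseteq> A" and F: "A \<subseteq> (\<Union>c\<in>F. {x \<in> carrier G. inv c \<otimes> x \<in> O'})"
  proof (rule compactin_finite_cover[OF A])
    fix c assume "c \<in> A"
    then have "c \<in> carrier G" using compactin_carrierD[OF A] by blast
    then show "openin T {x \<in> carrier G. inv c \<otimes> x \<in> O'} \<and> c \<in> {x \<in> carrier G. inv c \<otimes> x \<in> O'}"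
      using O by (auto intro!: openin_preimage continuous_map_group_intros)
  qed
  show thesis
  proof (rule that)
    show "\<exists>c\<in>F. inv c \<otimes> x \<in> O'" if "x \<in> A" for x
      using subsetD[OF F that] by simp
  qed fact+
qed

text \<open>Continuity of the group operations carries each closure condition from \<open>N\<close>
  over to its closure; for products, the closure of \<open>N \<times> N\<close> is the product of
  the closures.\<close>

lemma normal_closure_of:
  assumes "N \<lhd> G"
  shows "(T closure_of N) \<lhd> G"
proof (rule normal_invI)
  interpret normal N G by fact
  have cl: "T closure_of N \<subseteq> carrier G" using closure_of_subset_topspace by force
  show "subgroup (T closure_of N) G"
  proof
    fix x y assume "x \<in> T closure_of N" "y \<in> T closure_of N"
    then have "(x, y) \<in> prod_topology T T closure_of (N \<times> N)"
      by (simp add: closure_of_Times)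
    then have "x \<otimes> y \<in> T closure_of ((\<lambda>(x, y). x \<otimes> y) ` (N \<times> N))"
      using continuous_map_image_closure_subset[OF continuous_mult, of "N \<times> N"] by auto
    also have "\<dots> \<subseteq> T closure_of N" by (rule closure_of_mono) auto
    finally show "x \<otimes> y \<in> T closure_of N" .
  next
    show "\<one> \<in> T closure_of N" using closure_of_subset[of N T] subset by auto
  next
    fix x assume "x \<in> T closure_of N"
    then have "inv x \<in> T closure_of ((\<lambda>x. inv x) ` N)"
      using continuous_map_image_closure_subset[OF continuous_inv, of N] by auto
    also have "\<dots> \<subseteq> T closure_of N" by (rule closure_of_mono) auto
    finally show "inv x \<in> T closure_of N" .
  qed (use cl in auto)
  fix g x assume g: "g \<in> carrier G" and x: "x \<in> T closure_of N"
  have "continuous_map T T (\<lambda>x. g \<otimes> x \<otimes> inv g)"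
    using g by (intro continuous_map_group_intros) auto
  then have "g \<otimes> x \<otimes> inv g \<in> T closure_of ((\<lambda>x. g \<otimes> x \<otimes> inv g) ` N)"
    using continuous_map_image_closure_subset[of T T _ N] x by blast
  also have "\<dots> \<subseteq> T closure_of N" by (rule closure_of_mono) (use g inv_op_closed2 in auto)
  finally show "g \<otimes> x \<otimes> inv g \<in> T closure_of N" .
qed

text \<open>The closure of \<open>N\<close> is a closed normal subgroup containing
  \<open>x \<noteq> \<one>\<close>, so topological simplicity makes \<open>N\<close> dense.\<close>

lemma dense_normal_subgroup:
  assumes "topologically_simple G T" "N \<lhd> G" "x \<in> N" "x \<noteq> \<one>" "openin T A" "A \<noteq> {}"
  shows "N \<inter> A \<noteq> {}"
proof -
  interpret normal N G by fact
  have "x \<in> T closure_of N" using closure_of_subset[of N T] subset assms(3) by auto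
  then have "(T closure_of N) \<noteq> {\<one>}" using assms(4) by auto
  then have "(T closure_of N) = carrier G"
    using assms(1) normal_closure_of[OF assms(2)] closedin_closure_of[of T N]
    unfolding topologically_simple_def by metis
  then show ?thesis
    using assms(5,6) openin_carrierD[OF assms(5)] unfolding set_eq_iff in_closure_of by blast
qed

end

section \<open>Baire category arguments and compact open subgroups\<close>

context tdlc_group
begin

lemma regular: "regular_space T"
  by (rule locally_compact_Hausdorff_imp_regular_space[OF locally_compact Hausdorff])

lemma Baire_interior:
  assumes "countable \<G>" "\<And>C. C \<in> \<G> \<Longrightarrow> closedin T C" "openin T A" "A \<noteq> {}" "A \<subseteq> \<Union>\<G>"
  shows "\<exists>C\<in>\<G>. T interior_of C \<noteq> {}"
proof -
  have "T interior_of (\<Union>\<G>) \<noteq> {}"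
    using assms(3-5) interior_of_maximal by blast
  then show ?thesis
    using Baire_category_alt[of T \<G>] locally_compact regular assms(1,2) by blast
qed

text \<open>By Baire, one of the countably many closed cosets \<open>H f\<close> has an interior
  point; translating that point to the identity gives a neighbourhood inside
  \<open>H\<close>.\<close>

lemma openin_if_countable_mod:
  assumes H: "subgroup H G" "closedin T H" and F: "countable F" "F \<subseteq> carrier G"
    and A: "openin T A" "A \<noteq> {}" "A \<subseteq> H <#> F"
  shows "openin T H"
proof -
  interpret subgroup H G by fact
  have "H <#> F = \<Union>((\<lambda>f. H #> f) ` F)" by (auto simp: set_mult_def r_coset_def)
  then have "\<exists>C\<in>(\<lambda>f. H #> f) ` F. T interior_of C \<noteq> {}"
    using F A closedin_translate[OF H(2) subset] by (intro Baire_interior[where A = A]) auto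
  then obtain f where f: "f \<in> F" "T interior_of (H #> f) \<noteq> {}" by blast
  then obtain x where x: "x \<in> T interior_of (H #> f)" by blast
  have fc: "f \<in> carrier G" using f F by auto
  then have xH: "x \<in> H #> f" and xc: "x \<in> carrier G"
    using x interior_of_subset[of T "H #> f"] interior_of_subset_topspace[of T] by auto
  let ?A = "{y \<in> carrier G. y \<otimes> x \<in> T interior_of (H #> f)}"
  show ?thesis
  proof (rule openin_subgroupI[OF H(1), of ?A])
    show "openin T ?A" using xc by (intro openin_preimage continuous_map_group_intros) auto
    show "\<one> \<in> ?A" using x xc by simp
    show "?A \<subseteq> H"
    proof
      fix y assume y: "y \<in> ?A"
      then have "y \<otimes> x \<in> H #> f" using interior_of_subset[of T "H #> f"] by auto
      then obtain h h' where hh: "h \<in> H" "y \<otimes> x = h \<otimes> f" "h' \<in> H" "x = h' \<otimes> f"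
        using xH by (auto simp: r_coset_def)
      have "(y \<otimes> x) \<otimes> inv x = y" using y xc by (simp add: m_assoc)
      then have "y = (h \<otimes> f) \<otimes> inv (h' \<otimes> f)" using hh(2,4) by metis
      also have "\<dots> = h \<otimes> inv h'"
        using hh(1,3) fc by (simp add: inv_mult_group m_assoc)
      finally show "y \<in> H" using hh by simp
    qed
  qed
qed

text \<open>Total disconnectedness makes \<open>{\<one>}\<close> a connected component, and a
  compact component of a locally compact Hausdorff space has clopen neighbourhoods inside any given
  open neighbourhood. One inside a compact set is itself compact.\<close>

lemma compact_open_neighbourhood:
  obtains A where "compactin T A" "openin T A" "\<one> \<in> A"
proof -
  obtain W K where W: "openin T W" "compactin T K" "\<one> \<in> W" "W \<subseteq> K"
    using locally_compact unfolding locally_compact_space_def topspace by blast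
  have "connected_component_of_set T \<one> \<subseteq> {\<one>}"
    using totally_disconnected[OF connectedin_connected_component_of[of T \<one>]]
      connected_component_of_refl[of T \<one>] by auto
  then have "connected_component_of_set T \<one> = {\<one>}"
    using connected_component_of_refl[of T \<one>] by auto
  then have "{\<one>} \<in> connected_components_of T"
    unfolding connected_components_of_def by (intro image_eqI[of _ _ \<one>]) auto
  then obtain U V where U: "openin T U" "openin T V" "disjnt U V" "U \<union> V = topspace T"
      "{\<one>} \<subseteq> U" "U \<subseteq> W"
    using wilder_locally_compact_component_thm[OF locally_compact Hausdorff, of "{\<one>}" W] W
    by auto
  then have "topspace T - U = V" by (auto simp: disjnt_iff simp del: topspace)
  then have "closedin T U" using U(1,2) openin_subset unfolding closedin_def by metis
  then have "compactin T U" using W U closed_compactin by (meson order_trans)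
  then show thesis using U by (intro that[of U]) auto
qed

text \<open>Van Dantzig: inside a compact open neighbourhood \<open>A\<close> of the identity, the right stabiliser
  of \<open>A\<close> is open by Wallace's theorem.\<close>

lemma compact_open_subgroup_exists: "\<exists>U. compact_open_subgroup G T U"
proof -
  obtain A where A: "compactin T A" "openin T A" "\<one> \<in> A"
    by (rule compact_open_neighbourhood)
  have Ac: "A \<subseteq> carrier G" using A(1) by (rule compactin_carrierD)
  let ?U = "{g \<in> carrier G. A #> g = A}"
  have sub: "subgroup ?U G"
  proof
    fix g assume g: "g \<in> ?U"
    then have "A #> inv g = A #> (g \<otimes> inv g)"
      using coset_mult_assoc[OF Ac, of g "inv g"] by simp
    then show "inv g \<in> ?U" using g Ac by (simp add: coset_mult_one)
  qed (use Ac in \<open>auto simp: coset_mult_assoc[symmetric]\<close>)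
  let ?W = "{z \<in> topspace (prod_topology T T). (\<lambda>(x, y). x \<otimes> y) z \<in> A}"
  have "openin (prod_topology T T) ?W"
    by (rule openin_continuous_map_preimage[OF continuous_mult A(2)])
  moreover have "A \<times> {\<one>} \<subseteq> ?W" using Ac by auto
  ultimately obtain B V where V: "openin T B" "openin T V" "A \<subseteq> B" "{\<one>} \<subseteq> V" "B \<times> V \<subseteq> ?W"
    using Wallace_theorem_prod_topology[OF A(1), of T "{\<one>}" ?W] by auto
  \<comment> \<open>Passing to a symmetric neighbourhood gives both \<open>A v \<subseteq> A\<close>
    and \<open>A v^-1 \<subseteq> A\<close>, hence \<open>A v = A\<close>.\<close>
  let ?V = "V \<inter> {x \<in> carrier G. inv x \<in> V}"
  have AV: "a \<otimes> v \<in> A" if "a \<in> A" "v \<in> V" for a v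
    using subsetD[OF V(5), of "(a, v)"] that V(3) by auto
  have Usub: "?U \<subseteq> A"
  proof
    fix g assume g: "g \<in> ?U"
    then have "\<one> \<otimes> g \<in> A #> g" using A(3) unfolding r_coset_def by blast
    then show "g \<in> A" using g by simp
  qed
  have "openin T ?U"
  proof (rule openin_subgroupI[OF sub, of ?V])
    show "openin T ?V" using V(2) by (intro openin_Int openin_preimage continuous_map_group_intros)
    show "\<one> \<in> ?V" using V by simp
    show "?V \<subseteq> ?U"
    proof
      fix v assume v: "v \<in> ?V"
      have "a \<in> A #> v" if "a \<in> A" for a
      proof -
        have "a \<otimes> inv v \<in> A" using AV that v by simp
        moreover have "a = (a \<otimes> inv v) \<otimes> v" using that Ac v by (auto simp: m_assoc subset_iff)
        ultimately show ?thesis unfolding r_coset_def by blast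
      qed
      moreover have "A #> v \<subseteq> A" using AV v by (auto simp: r_coset_def)
      ultimately show "v \<in> ?U" using v by auto
    qed
  qed
  moreover have "compactin T ?U"
    using closed_compactin[OF A(1) Usub closedin_open_subgroup[OF sub]] calculation by blast
  ultimately show ?thesis using sub unfolding compact_open_subgroup_def by blast
qed

end

section \<open>Evaluation of words\<close>

definition letter_val :: "('a, 'b) monoid_scheme \<Rightarrow> ('x \<Rightarrow> 'a) \<Rightarrow> 'x \<times> bool \<Rightarrow> 'a" where
  "letter_val G f a = (if snd a then f (fst a) else inv\<^bsub>G\<^esub> f (fst a))"

text \<open>Unreduced words are allowed, so that words can be concatenated and formally inverted
  without cancellation.\<close>

definition word_val :: "('a, 'b) monoid_scheme \<Rightarrow> ('x \<Rightarrow> 'a) \<Rightarrow> ('x \<times> bool) list \<Rightarrow> 'a" where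
  "word_val G f w = foldr (\<lambda>a g. letter_val G f a \<otimes>\<^bsub>G\<^esub> g) w \<one>\<^bsub>G\<^esub>"

lemma word_val_Nil [simp]: "word_val G f [] = \<one>\<^bsub>G\<^esub>"
  and word_val_Cons [simp]: "word_val G f (a # w) = letter_val G f a \<otimes>\<^bsub>G\<^esub> word_val G f w"
  by (simp_all add: word_val_def)

lemma (in group) letter_val_inv_letter:
  "f (fst a) \<in> carrier G \<Longrightarrow> letter_val G f (inv_letter a) = inv (letter_val G f a)"
  by (simp add: letter_val_def inv_letter_def)

text \<open>Such an \<open>f\<close> corresponds to a homomorphism from the free group on
  \<open>X\<close>, namely \<open>word_val G f\<close>.\<close>

locale group_map = group G for G :: "('a, 'b) monoid_scheme" (structure) +
  fixes X :: "'x set" and f :: "'x \<Rightarrow> 'a"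
  assumes map_closed: "f \<in> X \<rightarrow> carrier G"
begin

abbreviation "words \<equiv> lists (X \<times> (UNIV :: bool set))"

lemma letter_val_closed [simp]: "a \<in> X \<times> UNIV \<Longrightarrow> letter_val G f a \<in> carrier G"
  using map_closed by (auto simp: letter_val_def)

lemma word_val_closed: "w \<in> words \<Longrightarrow> word_val G f w \<in> carrier G"
  by (induction w) auto

lemma word_val_append:
  "u \<in> words \<Longrightarrow> v \<in> words \<Longrightarrow> word_val G f (u @ v) = word_val G f u \<otimes> word_val G f v"
  by (induction u rule: lists.induct) (auto simp: m_assoc word_val_closed simp del: in_lists_conv_set)

lemma inv_word_in_words: "w \<in> words \<Longrightarrow> rev (map inv_letter w) \<in> words"
  by (auto simp: in_lists_conv_set inv_letter_def)

lemma word_val_inv: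
  assumes "w \<in> words"
  shows "word_val G f (rev (map inv_letter w)) = inv (word_val G f w)"
  using assms
proof (induction w rule: lists.induct)
  case (Cons a w)
  have [simp]: "letter_val G f (inv_letter a) = inv (letter_val G f a)"
    using Cons map_closed by (auto intro: letter_val_inv_letter)
  have "inv_letter a \<in> X \<times> UNIV" using Cons by simp
  then show ?case
    using Cons by (simp add: word_val_append inv_word_in_words word_val_closed inv_mult_group
        del: in_lists_conv_set)
qed simp

lemma word_val_cons_letter:
  assumes "a \<in> X \<times> UNIV" "w \<in> words"
  shows "word_val G f (cons_letter a w) = letter_val G f a \<otimes> word_val G f w"
proof (cases w)
  case (Cons b v)
  have b: "b \<in> X \<times> UNIV" and v: "v \<in> words"
    using assms(2) by (simp_all add: Cons del: in_lists_conv_set)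
  have "letter_val G f (inv_letter a) = inv (letter_val G f a)"
    using assms(1) map_closed by (auto intro: letter_val_inv_letter)
  then show ?thesis
    using assms(1) v by (auto simp: Cons cons_letter_def word_val_closed simp del: in_lists_conv_set)
qed (simp add: cons_letter_def)

lemma word_val_foldr_cons_letter:
  assumes "u \<in> words" "v \<in> words"
  shows "word_val G f (foldr cons_letter u v) = word_val G f u \<otimes> word_val G f v"
  using assms(1)
  by (induction u rule: lists.induct)
    (simp_all add: word_val_cons_letter word_val_closed assms(2) m_assoc
      foldr_cons_letter_in_lists del: in_lists_conv_set)

lemma word_val_hom: "word_val G f \<in> hom (free_group X) G"
  by (rule homI)
    (simp_all add: free_group_def word_val_closed word_val_foldr_cons_letter del: in_lists_conv_set)

lemma group_hom_word_val: "group_hom (free_group X) G (word_val G f)"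
  by (simp add: group_hom_def group_hom_axioms_def word_val_hom group_free_group)

text \<open>Folding \<open>cons_letter\<close> from the empty word gives the reduced form of
  \<open>w\<close>. This transfers statements about elements of the free group to arbitrary
  words.\<close>

lemma reduce_word:
  assumes "w \<in> words"
  shows "foldr cons_letter w [] \<in> carrier (free_group X)"
    and "word_val G f (foldr cons_letter w []) = word_val G f w"
  using assms foldr_cons_letter_in_lists[of w "X \<times> UNIV" "[]"] reduced_foldr_cons_letter[of "[]" w]
  by (simp_all add: free_group_def word_val_foldr_cons_letter word_val_closed
      reduced_def del: in_lists_conv_set)

end

text \<open>The uniqueness half of the universal property of the free group. A reduced word
  \<open>a # w\<close> is the product of \<open>[a]\<close> and \<open>w\<close>, which drives the
  induction.\<close>

lemma hom_free_group_eq_word_val: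
  assumes "group G" and \<theta>: "\<theta> \<in> hom (free_group X) G" and w: "w \<in> carrier (free_group X)"
  shows "\<theta> w = word_val G (\<theta> \<circ> free_gen) w"
proof -
  interpret group_hom "free_group X" G \<theta>
    using assms(1) \<theta> by (simp add: group_hom_def group_hom_axioms_def group_free_group)
  have "w \<in> lists (X \<times> UNIV)" "reduced w" using w by (auto simp: free_group_def)
  then show ?thesis
  proof (induction w rule: lists.induct)
    case Nil
    then show ?case using hom_one by (simp add: free_group_def)
  next
    case (Cons a w)
    obtain x b where a: "a = (x, b)" by (cases a)
    have x: "x \<in> X" using Cons a by simp
    have gen: "[(x, c)] \<in> carrier (free_group X)" for c
      using x by (simp add: free_group_def reduced_def)
    have w: "w \<in> carrier (free_group X)"
      using Cons reduced_Cons by (simp add: free_group_def)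
    have "a # w = cons_letter a w"
      using Cons.prems by (cases w) (auto simp: cons_letter_def reduced_def)
    then have "a # w = [a] \<otimes>\<^bsub>free_group X\<^esub> w" by (simp add: free_group_def)
    then have "\<theta> (a # w) = \<theta> [a] \<otimes>\<^bsub>G\<^esub> \<theta> w"
      using hom_mult[OF gen w, of b] a by simp
    moreover have "\<theta> [a] = letter_val G (\<theta> \<circ> free_gen) a"
    proof (cases b)
      case False
      have "[(x, False)] = inv\<^bsub>free_group X\<^esub> [(x, True)]"
        using gen G.inv_equality[of "[(x, False)]" "[(x, True)]"]
        by (simp add: free_group_def cons_letter_def inv_letter_def)
      then show ?thesis using False a gen by (simp add: letter_val_def free_gen_def)
    qed (simp add: a letter_val_def free_gen_def)
    ultimately show ?case using Cons.IH[OF reduced_Cons[OF Cons.prems]] by (simp add: o_def)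
  qed
qed

text \<open>The last property is an induction principle for relators: to see that \<open>h\<close>
  sends every word trivial in \<open>G\<close> into a normal subgroup \<open>W\<close> of
  \<open>Q\<close>, it suffices to check words of length at most \<open>n\<close>.\<close>

lemma compactly_presented_words:
  fixes G :: "('a, 'b) monoid_scheme"
  assumes "group G" "compactly_presented TYPE('x) G T"
  obtains X :: "'x set" and f n where
    "f \<in> X \<rightarrow> carrier G" "compactin T (f ` X)"
    "\<And>g. g \<in> carrier G \<Longrightarrow> \<exists>w\<in>lists (X \<times> UNIV). word_val G f w = g"
    "\<And>(Q :: ('a, 'b) monoid_scheme) h W. \<lbrakk>group Q; h \<in> X \<rightarrow> carrier Q; W \<lhd> Q;
       \<And>w. w \<in> lists (X \<times> UNIV) \<Longrightarrow> length w \<le> n \<Longrightarrow> word_val G f w = \<one>\<^bsub>G\<^esub> \<Longrightarrow> word_val Q h w \<in> W\<rbrakk>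
       \<Longrightarrow> \<forall>w\<in>lists (X \<times> UNIV). word_val G f w = \<one>\<^bsub>G\<^esub> \<longrightarrow> word_val Q h w \<in> W"
proof -
  interpret group G by fact
  obtain X :: "'x set" and \<theta> R n where \<theta>: "\<theta> \<in> epi (free_group X) G"
    and comp: "compactin T (\<theta> ` free_gen ` X)"
    and R: "R \<subseteq> carrier (free_group X)" "\<forall>r\<in>R. length r \<le> n"
    and ker: "kernel (free_group X) G \<theta> = (\<lambda>N. N \<lhd> free_group X) hull R"
    using assms(2) unfolding compactly_presented_def by blast
  define f where "f = \<theta> \<circ> free_gen"
  have hom: "\<theta> \<in> hom (free_group X) G" and surj: "\<theta> ` carrier (free_group X) = carrier G"
    using \<theta> by (auto simp: epi_def)
  have gen: "free_gen x \<in> carrier (free_group X)" if "x \<in> X" for x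
    using that by (simp add: free_group_def free_gen_def reduced_def)
  have f: "f \<in> X \<rightarrow> carrier G"
    using gen hom by (auto simp: f_def hom_def)
  interpret f: group_map G X f by unfold_locales (rule f)
  have eq: "\<theta> w = word_val G f w" if "w \<in> carrier (free_group X)" for w
    unfolding f_def by (rule hom_free_group_eq_word_val[OF assms(1) hom that])
  show thesis
  proof (rule that[of f X n])
    show "compactin T (f ` X)" using comp by (simp add: f_def image_comp)
    show "\<exists>w\<in>lists (X \<times> UNIV). word_val G f w = g" if "g \<in> carrier G" for g
    proof -
      have "g \<in> \<theta> ` carrier (free_group X)" using that by (simp only: surj)
      then obtain w where w: "w \<in> carrier (free_group X)" "\<theta> w = g" by blast
      then show ?thesis using eq[OF w(1)] by (intro bexI[of _ w]) (auto simp: free_group_def)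
    qed
    fix Q :: "('a, 'b) monoid_scheme" and h W
    assume Q: "group Q" "h \<in> X \<rightarrow> carrier Q" "W \<lhd> Q"
      and short: "\<And>w. w \<in> lists (X \<times> UNIV) \<Longrightarrow> length w \<le> n \<Longrightarrow> word_val G f w = \<one>\<^bsub>G\<^esub> \<Longrightarrow>
        word_val Q h w \<in> W"
    interpret h: group_map Q X h
      using Q(1,2) by (simp add: group_map_def group_map_axioms_def)
    \<comment> \<open>This preimage of \<open>W\<close> is normal and contains the relators
      \<open>R\<close>, hence also their normal closure, the kernel of
      \<open>\<theta>\<close>.\<close>
    let ?N = "{w \<in> carrier (free_group X). word_val Q h w \<in> W}"
    have "R \<subseteq> kernel (free_group X) G \<theta>" unfolding ker by (rule hull_subset)
    have "r \<in> ?N" if "r \<in> R" for r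
    proof -
      have r: "r \<in> carrier (free_group X)" "\<theta> r = \<one>\<^bsub>G\<^esub>"
        using that \<open>R \<subseteq> kernel (free_group X) G \<theta>\<close> by (auto simp: kernel_def)
      moreover have "r \<in> lists (X \<times> UNIV)" using r by (simp add: free_group_def)
      ultimately show ?thesis using short[of r] eq[of r] R(2) that by simp
    qed
    then have "R \<subseteq> ?N" by blast
    moreover have "?N \<lhd> free_group X"
      by (rule h.normal_preimage[OF Q(3) h.group_hom_word_val])
    ultimately have "kernel (free_group X) G \<theta> \<subseteq> ?N"
      unfolding ker by (intro hull_minimal)
    then have "word_val Q h w \<in> W" if "w \<in> carrier (free_group X)" "word_val G f w = \<one>\<^bsub>G\<^esub>" for w
      using that eq unfolding kernel_def by auto
    then show "\<forall>w\<in>lists (X \<times> UNIV). word_val G f w = \<one>\<^bsub>G\<^esub> \<longrightarrow> word_val Q h w \<in> W"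
      using f.reduce_word h.reduce_word by metis
  qed (fact f)
qed

section \<open>Commensurated closed normal subgroups of a compact open subgroup\<close>

text \<open>A coset meeting \<open>A\<close> can be represented by a point of \<open>A\<close>. The
  representatives then inherit properties of \<open>A\<close>, such as lying in
  \<open>germ_centralizer\<close>.\<close>

lemma (in group) finite_mod_representatives:
  assumes H: "subgroup H G" and A: "finite_mod H A" "A \<subseteq> carrier G"
  obtains A' where "finite A'" "A' \<subseteq> A" "A \<subseteq> H <#> A'"
proof -
  interpret subgroup H G by fact
  obtain F where F: "finite F" "F \<subseteq> carrier G" "A \<subseteq> H <#> F"
    using A unfolding finite_mod_def by blast
  define r where "r f = (SOME a. a \<in> A \<and> a \<in> H #> f)" for f
  define F' where "F' = {f \<in> F. \<exists>a. a \<in> A \<and> a \<in> H #> f}"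
  have r: "r f \<in> A" "r f \<in> H #> f" if "f \<in> F'" for f
    using someI_ex[of "\<lambda>a. a \<in> A \<and> a \<in> H #> f"] that unfolding r_def F'_def by auto
  have "a \<in> H <#> r ` F'" if a: "a \<in> A" for a
  proof -
    obtain h f where hf: "h \<in> H" "f \<in> F" "a = h \<otimes> f"
      using a F(3) by (blast elim: set_mult_memE)
    have f: "f \<in> F'" "f \<in> carrier G"
      using hf a F(2) unfolding F'_def r_coset_def by auto
    then obtain h' where h': "h' \<in> H" "r f = h' \<otimes> f"
      using r(2) by (auto simp: r_coset_def)
    have "a = (h \<otimes> inv h') \<otimes> r f"
      using hf(1,3) h' f by (simp add: m_assoc)
    then show ?thesis using hf(1) h'(1) f by (auto intro!: set_mult_memI)
  qed
  moreover have "finite (r ` F')" "r ` F' \<subseteq> A"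
    using F(1) r by (auto simp: F'_def)
  ultimately show thesis using that by blast
qed

lemma (in group) word_val_subgroup:
  assumes "subgroup U G" "h \<in> X \<rightarrow> U" "w \<in> lists (X \<times> UNIV)"
  shows "word_val (G\<lparr>carrier := U\<rparr>) h w = word_val G h w"
  using assms(3)
proof (induction w rule: lists.induct)
  case (Cons a w)
  then have "h (fst a) \<in> U" using assms(2) by auto
  then show ?case
    using Cons.IH m_inv_consistent[OF assms(1)] by (simp add: letter_val_def)
qed simp

text \<open>The last assumption makes \<open>gHg^-1 \<inter> H\<close> open in
  \<open>gHg^-1\<close>. Applied to \<open>g\<close> and to \<open>g^-1\<close>, it says that
  \<open>H\<close> and \<open>gHg^-1\<close> are commensurate, since \<open>H\<close> is
  compact.\<close>

locale commensurated_subgroup = tdlc_group +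
  fixes U H
  assumes compact_open: "compact_open_subgroup G T U"
    and subgroup_H: "subgroup H G"
    and closed_H: "closedin T H"
    and H_subset: "H \<subseteq> U"
    and H_conj: "\<And>u h. u \<in> U \<Longrightarrow> h \<in> H \<Longrightarrow> u \<otimes> h \<otimes> inv u \<in> H"
    and commensurated: "\<And>g. g \<in> carrier G \<Longrightarrow>
      \<exists>A. openin T A \<and> \<one> \<in> A \<and> A \<inter> conj_set G g H \<subseteq> H"
begin

abbreviation "comm x y \<equiv> x \<otimes> y \<otimes> inv x \<otimes> inv y"

sublocale U: subgroup U G
  using compact_open by (simp add: compact_open_subgroup_def)

sublocale H: subgroup H G
  by (rule subgroup_H)

lemma open_U: "openin T U" and compact_U: "compactin T U"
  using compact_open by (simp_all add: compact_open_subgroup_def)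

lemma H_conj': "u \<in> U \<Longrightarrow> h \<in> H \<Longrightarrow> inv u \<otimes> h \<otimes> u \<in> H"
  using H_conj[of "inv u" h] by simp

lemma comm_inv: "x \<in> carrier G \<Longrightarrow> y \<in> carrier G \<Longrightarrow> inv (comm x y) = comm y x"
  by (simp add: inv_mult_group m_assoc)

lemma conj_H_nearby:
  assumes "g \<in> carrier G"
  obtains A where "openin T A" "\<one> \<in> A" "\<And>h. h \<in> H \<Longrightarrow> g \<otimes> h \<otimes> inv g \<in> A \<Longrightarrow> g \<otimes> h \<otimes> inv g \<in> H"
proof -
  obtain A where A: "openin T A" "\<one> \<in> A" "A \<inter> conj_set G g H \<subseteq> H"
    using commensurated[OF assms] by blast
  have "g \<otimes> h \<otimes> inv g \<in> conj_set G g H" if "h \<in> H" for h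
    using that by (auto simp: conj_set_def l_coset_def r_coset_def)
  with A show thesis by (intro that[of A]) auto
qed

text \<open>\<open>gHg^-1\<close> is compact, hence covered by finitely many translates
  \<open>A c\<close> with \<open>c\<close> in it; for \<open>x\<close> in \<open>A c\<close>, the
  quotient \<open>x c^-1\<close> lies in \<open>gHg^-1\<close> and in \<open>A\<close>, hence in
  \<open>H\<close>.\<close>

lemma finite_mod_conj_H:
  assumes g: "g \<in> carrier G"
  shows "finite_mod H (conj_set G g H)"
proof -
  obtain A where A: "openin T A" "\<one> \<in> A" "\<And>h. h \<in> H \<Longrightarrow> g \<otimes> h \<otimes> inv g \<in> A \<Longrightarrow> g \<otimes> h \<otimes> inv g \<in> H"
    using conj_H_nearby[OF g] by blast
  have eq: "conj_set G g H = (\<lambda>h. g \<otimes> h \<otimes> inv g) ` H"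
    by (auto simp: conj_set_def l_coset_def r_coset_def)
  have "compactin T H" using closed_compactin[OF compact_U H_subset closed_H] .
  then have "compactin T (conj_set G g H)"
    unfolding eq using g by (intro compactin_image continuous_map_group_intros) auto
  then obtain F where F: "finite F" "F \<subseteq> conj_set G g H"
      "\<And>x. x \<in> conj_set G g H \<Longrightarrow> \<exists>c\<in>F. x \<otimes> inv c \<in> A"
    using finite_right_cover[of "conj_set G g H" A] A(1,2) by metis
  have Fc: "F \<subseteq> carrier G" using F(2) g by (auto simp: eq)
  have "x \<in> H <#> F" if x: "x \<in> conj_set G g H" for x
  proof -
    obtain c where c: "c \<in> F" "x \<otimes> inv c \<in> A" using F(3)[OF x] by blast
    obtain h h' where h: "h \<in> H" "x = g \<otimes> h \<otimes> inv g" "h' \<in> H" "c = g \<otimes> h' \<otimes> inv g"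
      using x c(1) F(2) by (auto simp: eq)
    have "x \<otimes> inv c = g \<otimes> (h \<otimes> inv h') \<otimes> inv g"
      using h(1,3) g unfolding h(2,4) by (simp add: inv_mult_group m_assoc)
    then have "x \<otimes> inv c \<in> H" using A(3)[of "h \<otimes> inv h'"] c(2) h by simp
    moreover have "x = (x \<otimes> inv c) \<otimes> c" using h(1,3) g unfolding h(2,4) by (simp add: m_assoc inv_mult_group)
    ultimately show ?thesis using c(1) set_mult_memI by metis
  qed
  then show ?thesis using F(1) Fc unfolding finite_mod_def by blast
qed

text \<open>The elements acting trivially by conjugation on the germ of \<open>U / H\<close> at the identity.\<close>

definition germ_centralizer :: "'a set" where
  "germ_centralizer = {g \<in> carrier G. \<exists>A. openin T A \<and> \<one> \<in> A \<and> (\<forall>v\<in>A. comm v g \<in> H)}"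

text \<open>The commutators to be controlled are built from conjugates \<open>a h a^-1\<close> of
  commutators \<open>h\<close> in \<open>H\<close>. Such a conjugate returns to \<open>H\<close>
  once it is close to \<open>\<one>\<close>, and it is close to \<open>\<one>\<close> for
  \<open>v\<close> near \<open>\<one>\<close> because commutators are continuous.\<close>

lemma germ_centralizer_normal: "germ_centralizer \<lhd> G"
proof -
  have conj_cont: "openin T {v \<in> carrier G. a \<otimes> comm (b \<otimes> v \<otimes> inv b) g \<otimes> inv a \<in> A} \<and>
      \<one> \<in> {v \<in> carrier G. a \<otimes> comm (b \<otimes> v \<otimes> inv b) g \<otimes> inv a \<in> A}"
    if "a \<in> carrier G" "b \<in> carrier G" "g \<in> carrier G" "openin T A" "\<one> \<in> A" for a b g A
  proof
    show "openin T {v \<in> carrier G. a \<otimes> comm (b \<otimes> v \<otimes> inv b) g \<otimes> inv a \<in> A}"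
      using that by (intro openin_preimage continuous_map_group_intros) auto
  qed (use that in \<open>simp add: m_assoc\<close>)
  \<comment> \<open>The pair \<open>(a, b)\<close> will be \<open>(x, \<one>)\<close> for products,
    \<open>(inv x, \<one>)\<close> for inverses and \<open>(g, inv g)\<close> for
    conjugates.\<close>
  have near: "\<exists>C. openin T C \<and> \<one> \<in> C \<and> (\<forall>v\<in>C. a \<otimes> comm (b \<otimes> v \<otimes> inv b) g \<otimes> inv a \<in> H)"
    if a: "a \<in> carrier G" and b: "b \<in> carrier G" and g: "g \<in> germ_centralizer" for a b g
  proof -
    have gc: "g \<in> carrier G" using g by (simp add: germ_centralizer_def)
    obtain A where A: "openin T A" "\<one> \<in> A" "\<forall>v\<in>A. comm v g \<in> H"
      using g unfolding germ_centralizer_def by blast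
    obtain B where B: "openin T B" "\<one> \<in> B"
        "\<And>h. h \<in> H \<Longrightarrow> a \<otimes> h \<otimes> inv a \<in> B \<Longrightarrow> a \<otimes> h \<otimes> inv a \<in> H"
      using conj_H_nearby[OF a] by blast
    let ?C = "{v \<in> carrier G. a \<otimes> comm (b \<otimes> v \<otimes> inv b) g \<otimes> inv a \<in> B} \<inter>
      {v \<in> carrier G. b \<otimes> v \<otimes> inv b \<in> A}"
    have "openin T {v \<in> carrier G. b \<otimes> v \<otimes> inv b \<in> A}"
      using b A by (intro openin_preimage continuous_map_group_intros) auto
    then have "openin T ?C" "\<one> \<in> ?C"
      using conj_cont[OF a b gc B(1,2)] A(2) b by auto
    moreover have "\<forall>v\<in>?C. a \<otimes> comm (b \<otimes> v \<otimes> inv b) g \<otimes> inv a \<in> H"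
      using A(3) B(3) by blast
    ultimately show ?thesis by blast
  qed
  show ?thesis
  proof (rule normal_invI)
    show "subgroup germ_centralizer G"
    proof
      show "germ_centralizer \<subseteq> carrier G" by (auto simp: germ_centralizer_def)
      show "\<one> \<in> germ_centralizer"
        using open_U U.one_closed by (auto simp: germ_centralizer_def)
    next
      fix x y assume x: "x \<in> germ_centralizer" and y: "y \<in> germ_centralizer"
      then have c: "x \<in> carrier G" "y \<in> carrier G" by (simp_all add: germ_centralizer_def)
      obtain A where A: "openin T A" "\<one> \<in> A" "\<forall>v\<in>A. comm v x \<in> H"
        using x unfolding germ_centralizer_def by blast
      obtain B where B: "openin T B" "\<one> \<in> B" "\<forall>v\<in>B. x \<otimes> comm (\<one> \<otimes> v \<otimes> inv \<one>) y \<otimes> inv x \<in> H"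
        using near[OF c(1) one_closed y] by blast
      have "comm v (x \<otimes> y) \<in> H" if "v \<in> A \<inter> B" for v
      proof -
        have v: "v \<in> carrier G" using that openin_carrierD[OF A(1)] by blast
        have "comm v (x \<otimes> y) = comm v x \<otimes> (x \<otimes> comm (\<one> \<otimes> v \<otimes> inv \<one>) y \<otimes> inv x)"
          using v c by (simp add: m_assoc inv_mult_group)
        then show ?thesis using that A(3) B(3) by simp
      qed
      then show "x \<otimes> y \<in> germ_centralizer"
        using c A B unfolding germ_centralizer_def by (auto intro!: exI[of _ "A \<inter> B"])
    next
      fix x assume x: "x \<in> germ_centralizer"
      then have c: "x \<in> carrier G" by (simp add: germ_centralizer_def)
      obtain B where B: "openin T B" "\<one> \<in> B"
          "\<forall>v\<in>B. inv x \<otimes> comm (\<one> \<otimes> v \<otimes> inv \<one>) x \<otimes> inv (inv x) \<in> H"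
        using near[OF inv_closed[OF c] one_closed x] by blast
      have "comm v (inv x) \<in> H" if "v \<in> B" for v
      proof -
        have v: "v \<in> carrier G" using that openin_carrierD[OF B(1)] by blast
        have "comm v (inv x) = inv (inv x \<otimes> comm (\<one> \<otimes> v \<otimes> inv \<one>) x \<otimes> inv (inv x))"
          using v c by (simp add: m_assoc inv_mult_group)
        then show ?thesis using that B(3) by (metis H.m_inv_closed)
      qed
      then show "inv x \<in> germ_centralizer"
        using c B unfolding germ_centralizer_def by blast
    qed
  next
    fix g x assume g: "g \<in> carrier G" and x: "x \<in> germ_centralizer"
    then have c: "x \<in> carrier G" by (simp add: germ_centralizer_def)
    obtain B where B: "openin T B" "\<one> \<in> B"
        "\<forall>v\<in>B. g \<otimes> comm (inv g \<otimes> v \<otimes> inv (inv g)) x \<otimes> inv g \<in> H"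
      using near[OF g inv_closed[OF g] x] by blast
    have "comm v (g \<otimes> x \<otimes> inv g) \<in> H" if "v \<in> B" for v
    proof -
      have v: "v \<in> carrier G" using that openin_carrierD[OF B(1)] by blast
      have "comm v (g \<otimes> x \<otimes> inv g) = g \<otimes> comm (inv g \<otimes> v \<otimes> inv (inv g)) x \<otimes> inv g"
        using v c g by (simp add: m_assoc inv_mult_group)
      then show ?thesis using that B(3) by simp
    qed
    then show "g \<otimes> x \<otimes> inv g \<in> germ_centralizer"
      using c g B unfolding germ_centralizer_def by blast
  qed
qed

sublocale K: normal germ_centralizer G
  by (rule germ_centralizer_normal)

lemma H_subset_germ_centralizer: "H \<subseteq> germ_centralizer"
proof
  fix h assume h: "h \<in> H"
  have "\<forall>v\<in>U. comm v h \<in> H" using H_conj h by simp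
  then show "h \<in> germ_centralizer"
    using open_U U.one_closed H.mem_carrier[OF h]
    unfolding germ_centralizer_def by (intro CollectI conjI exI[of _ U])
qed

text \<open>If the commutators of \<open>A\<close> with \<open>p\<close> lie in \<open>H\<close>,
  then conjugating \<open>p\<close> by \<open>c a\<close> or by \<open>c\<close> gives the same
  coset of \<open>H\<close>, since \<open>c\<close> normalises \<open>H\<close>. Compactness of
  \<open>U\<close> leaves finitely many \<open>c\<close>.\<close>

lemma finite_mod_conj_germ_centralizer:
  assumes p: "p \<in> germ_centralizer"
  shows "finite_mod H ((\<lambda>u. u \<otimes> p \<otimes> inv u) ` U)"
proof -
  have pc: "p \<in> carrier G" using p by simp
  obtain A where A: "openin T A" "\<one> \<in> A" "\<forall>v\<in>A. comm v p \<in> H"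
    using p unfolding germ_centralizer_def by blast
  obtain F where F: "finite F" "F \<subseteq> U" "\<And>u. u \<in> U \<Longrightarrow> \<exists>c\<in>F. inv c \<otimes> u \<in> A"
    using finite_left_cover[OF compact_U A(1,2)] by metis
  have "u \<otimes> p \<otimes> inv u \<in> H <#> (\<lambda>c. c \<otimes> p \<otimes> inv c) ` F" if u: "u \<in> U" for u
  proof -
    obtain c where c: "c \<in> F" "inv c \<otimes> u \<in> A" using F(3)[OF u] by blast
    then have cU: "c \<in> U" using F by blast
    have "u \<otimes> p \<otimes> inv u = (c \<otimes> comm (inv c \<otimes> u) p \<otimes> inv c) \<otimes> (c \<otimes> p \<otimes> inv c)"
      using u cU pc by (simp add: m_assoc inv_mult_group)
    moreover have "c \<otimes> comm (inv c \<otimes> u) p \<otimes> inv c \<in> H"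
      using H_conj[OF cU] A(3) c(2) by blast
    ultimately show ?thesis using c(1) by (auto intro!: set_mult_memI)
  qed
  moreover have "(\<lambda>c. c \<otimes> p \<otimes> inv c) ` F \<subseteq> carrier G" using F(2) pc by auto
  ultimately show ?thesis
    using F(1) unfolding finite_mod_def by (intro exI[of _ "(\<lambda>c. c \<otimes> p \<otimes> inv c) ` F"]) auto
qed

section \<open>Centralisers in \<open>U\<close> modulo \<open>H\<close>\<close>

definition centralizer_mod :: "'a set \<Rightarrow> 'a set" where
  "centralizer_mod A = {v \<in> U. \<forall>y\<in>A. comm v y \<in> H}"

lemma centralizer_mod_subgroup:
  assumes "A \<subseteq> U"
  shows "subgroup (centralizer_mod A) G"
proof
  fix x y assume xy: "x \<in> centralizer_mod A" "y \<in> centralizer_mod A"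
  then have U: "x \<in> U" "y \<in> U" by (simp_all add: centralizer_mod_def)
  have "comm (x \<otimes> y) a \<in> H" if a: "a \<in> A" for a
  proof -
    have aU: "a \<in> U" using a assms by blast
    have "comm (x \<otimes> y) a = (x \<otimes> comm y a \<otimes> inv x) \<otimes> comm x a"
      using U aU by (simp add: m_assoc inv_mult_group)
    moreover have "comm x a \<in> H" "comm y a \<in> H" using a xy by (auto simp: centralizer_mod_def)
    ultimately show ?thesis using H_conj[OF U(1)] by simp
  qed
  then show "x \<otimes> y \<in> centralizer_mod A" using U by (simp add: centralizer_mod_def)
next
  fix x assume x: "x \<in> centralizer_mod A"
  then have U: "x \<in> U" by (simp add: centralizer_mod_def)
  have "comm (inv x) a \<in> H" if a: "a \<in> A" for a
  proof -
    have aU: "a \<in> U" using a assms by blast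
    have "comm (inv x) a = inv x \<otimes> inv (comm x a) \<otimes> x"
      using U aU by (simp add: m_assoc inv_mult_group)
    moreover have "comm x a \<in> H" using a x by (simp add: centralizer_mod_def)
    ultimately show ?thesis using H_conj'[OF U, of "inv (comm x a)"] by simp
  qed
  then show "inv x \<in> centralizer_mod A" using U by (simp add: centralizer_mod_def)
qed (use assms in \<open>auto simp: centralizer_mod_def subset_iff\<close>)

lemma centralizer_mod_conj:
  assumes A: "A \<subseteq> U" "\<And>u a. u \<in> U \<Longrightarrow> a \<in> A \<Longrightarrow> u \<otimes> a \<otimes> inv u \<in> A"
    and u: "u \<in> U" and x: "x \<in> centralizer_mod A"
  shows "u \<otimes> x \<otimes> inv u \<in> centralizer_mod A"
proof -
  have xU: "x \<in> U" using x by (simp add: centralizer_mod_def)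
  have "comm (u \<otimes> x \<otimes> inv u) a \<in> H" if a: "a \<in> A" for a
  proof -
    have aU: "a \<in> U" using a A(1) by blast
    have "inv u \<otimes> a \<otimes> u \<in> A" using A(2)[of "inv u" a] a u by simp
    then have "comm x (inv u \<otimes> a \<otimes> u) \<in> H" using x by (simp add: centralizer_mod_def)
    moreover have "comm (u \<otimes> x \<otimes> inv u) a = u \<otimes> comm x (inv u \<otimes> a \<otimes> u) \<otimes> inv u"
      using u xU aU by (simp add: m_assoc inv_mult_group)
    ultimately show ?thesis using H_conj[OF u] by simp
  qed
  then show ?thesis using u xU by (simp add: centralizer_mod_def)
qed

text \<open>Inverting a commutator exchanges its entries.\<close>

lemma centralizer_mod_symmetric:
  assumes "B \<subseteq> U" "A \<subseteq> centralizer_mod B"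
  shows "B \<subseteq> centralizer_mod A"
proof
  fix b assume b: "b \<in> B"
  have "comm b a \<in> H" if a: "a \<in> A" for a
  proof -
    have "a \<in> U" "comm a b \<in> H" using subsetD[OF assms(2) a] b by (simp_all add: centralizer_mod_def)
    moreover have "b \<in> U" using b assms(1) by blast
    ultimately show ?thesis using comm_inv[of a b] H.m_inv_closed[of "comm a b"] by simp
  qed
  then show "b \<in> centralizer_mod A" using b assms(1) by (auto simp: centralizer_mod_def)
qed

text \<open>The condition on \<open>v\<close> depends on \<open>y\<close> only through its coset of
  \<open>H\<close>, so finitely many representatives suffice. Each of them lies in
  \<open>germ_centralizer\<close> and contributes one open neighbourhood.\<close>

lemma openin_centralizer_mod:
  assumes Y: "Y \<subseteq> U" "Y \<subseteq> germ_centralizer" "finite_mod H Y"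
  shows "openin T (centralizer_mod Y)"
proof -
  obtain Z where Z: "finite Z" "Z \<subseteq> Y" "Y \<subseteq> H <#> Z"
    using finite_mod_representatives[OF subgroup_H Y(3)] Y(1) U.subset by blast
  have "\<forall>z\<in>Z. \<exists>A. openin T A \<and> \<one> \<in> A \<and> (\<forall>v\<in>A. comm v z \<in> H)"
    using Z(2) Y(2) unfolding germ_centralizer_def by blast
  then obtain A where A: "\<And>z. z \<in> Z \<Longrightarrow> openin T (A z) \<and> \<one> \<in> A z \<and> (\<forall>v\<in>A z. comm v z \<in> H)"
    by metis
  show ?thesis
  proof (rule openin_subgroupI[OF centralizer_mod_subgroup[OF Y(1)]])
    show "openin T (U \<inter> \<Inter>(A ` Z))"
    \<comment> \<open>The empty intersection is \<open>UNIV\<close>, which need not be open in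
      \<open>T\<close>.\<close>
    proof (cases "Z = {}")
      case False
      then have "openin T (\<Inter>(A ` Z))" using A Z(1) by (intro openin_Inter) auto
      then show ?thesis using open_U by blast
    qed (simp add: open_U)
    show "\<one> \<in> U \<inter> \<Inter>(A ` Z)" using A by auto
    show "U \<inter> \<Inter>(A ` Z) \<subseteq> centralizer_mod Y"
    proof
      fix v assume v: "v \<in> U \<inter> \<Inter>(A ` Z)"
      have "comm v y \<in> H" if y: "y \<in> Y" for y
      proof -
        obtain h z where hz: "h \<in> H" "z \<in> Z" "y = h \<otimes> z"
          using y Z(3) by (blast elim: set_mult_memE)
        then have zc: "z \<in> carrier G" using Z(2) Y(1) U.subset by blast
        have "comm v y = (v \<otimes> h \<otimes> inv v) \<otimes> comm v z \<otimes> inv h"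
          using v zc hz by (simp add: m_assoc inv_mult_group)
        then show ?thesis using H_conj[of v h] v hz A[OF hz(2)] by auto
      qed
      then show "v \<in> centralizer_mod Y" using v by (simp add: centralizer_mod_def)
    qed
  qed
qed

text \<open>The letters lie in finitely many open cosets \<open>c U\<close>. The subgroup
  \<open>germ_centralizer\<close> is dense, so each of these cosets is \<open>k U\<close> with
  \<open>k\<close> in it, and every letter is \<open>k\<close> times an element of
  \<open>U\<close>.\<close>

lemma letters_modulo_U:
  assumes simple: "topologically_simple G T" and nontriv: "H \<noteq> {\<one>}"
    and f: "f \<in> X \<rightarrow> carrier G" "compactin T (f ` X)"
  obtains \<psi> where "\<psi> \<in> X \<rightarrow> U" "finite ((\<lambda>x. f x \<otimes> inv (\<psi> x)) ` X)"
    "(\<lambda>x. f x \<otimes> inv (\<psi> x)) ` X \<subseteq> germ_centralizer"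
proof -
  obtain h where h: "h \<in> H" "h \<noteq> \<one>" using nontriv H.one_closed by blast
  obtain F where F: "finite F" "F \<subseteq> f ` X" "\<And>y. y \<in> f ` X \<Longrightarrow> \<exists>c\<in>F. inv c \<otimes> y \<in> U"
    using finite_left_cover[OF f(2) open_U U.one_closed] by metis
  have "\<exists>k\<in>germ_centralizer. inv k \<otimes> c \<in> U" if "c \<in> F" for c
  proof -
    have c: "c \<in> carrier G" using that F(2) f(1) by auto
    let ?A = "{k \<in> carrier G. inv k \<otimes> c \<in> U}"
    have "openin T ?A" using c open_U by (intro openin_preimage continuous_map_group_intros) auto
    moreover have "c \<in> ?A" using c by simp
    ultimately show ?thesis
      using dense_normal_subgroup[OF simple germ_centralizer_normal _ h(2), of ?A]
        H_subset_germ_centralizer h(1) by blast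
  qed
  then obtain k where k: "\<And>c. c \<in> F \<Longrightarrow> k c \<in> germ_centralizer \<and> inv (k c) \<otimes> c \<in> U"
    by metis
  have "\<forall>x\<in>X. \<exists>c. c \<in> F \<and> inv c \<otimes> f x \<in> U" using F(3) by blast
  then obtain c where c: "\<And>x. x \<in> X \<Longrightarrow> c x \<in> F \<and> inv (c x) \<otimes> f x \<in> U"
    by metis
  define \<psi> where "\<psi> x = inv (k (c x)) \<otimes> f x" for x
  have eq: "f x \<otimes> inv (\<psi> x) = k (c x)" and \<psi>: "\<psi> x \<in> U" if x: "x \<in> X" for x
  proof -
    have fx: "f x \<in> carrier G" using x f(1) by auto
    have cx: "c x \<in> carrier G" using c[OF x] F(2) compactin_carrierD[OF f(2)] by blast
    have kx: "k (c x) \<in> carrier G" using k[of "c x"] c[OF x] by simp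
    show "f x \<otimes> inv (\<psi> x) = k (c x)"
      using fx kx by (simp add: \<psi>_def inv_mult_group)
    have "\<psi> x = (inv (k (c x)) \<otimes> c x) \<otimes> (inv (c x) \<otimes> f x)"
      using fx cx kx by (simp add: \<psi>_def m_assoc)
    then show "\<psi> x \<in> U" using k c[OF x] by simp
  qed
  have "(\<lambda>x. f x \<otimes> inv (\<psi> x)) ` X \<subseteq> k ` F" using eq c by auto
  moreover have "k ` F \<subseteq> germ_centralizer" using k by auto
  ultimately show thesis
    using that[of \<psi>] \<psi> F(1) finite_subset[of _ "k ` F"] by (meson Pi_I finite_imageI order_trans)
qed

text \<open>The values of the words of length \<open>k\<close> form the compact set
  \<open>set_power G A k\<close>. By Baire one of these sets has interior, and finitely many
  translates of this interior cover \<open>C\<close>.\<close>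

lemma bounded_word_lengths:
  assumes f: "f \<in> X \<rightarrow> carrier G" "compactin T (f ` X)"
    and gen: "\<And>g. g \<in> carrier G \<Longrightarrow> \<exists>w\<in>lists (X \<times> UNIV). word_val G f w = g"
    and C: "compactin T C"
  obtains L where "\<And>c. c \<in> C \<Longrightarrow> \<exists>w\<in>lists (X \<times> UNIV). length w \<le> L \<and> word_val G f w = c"
proof -
  interpret f: group_map G X f by unfold_locales (rule f)
  define A where "A = f ` X \<union> (\<lambda>x. inv x) ` f ` X"
  have "continuous_map T T (\<lambda>x. inv x)" by (rule continuous_inv)
  then have comp: "compactin T (set_power G A k)" for k
    unfolding A_def using f(2) by (intro compactin_set_power compactin_Un compactin_image)
  have A_word: "\<exists>w\<in>lists (X \<times> UNIV). length w = k \<and> word_val G f w = x" if "x \<in> set_power G A k" for x k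
    using that
  proof (induction k arbitrary: x)
    case (Suc k)
    then obtain a y where ay: "a \<in> A" "y \<in> set_power G A k" "x = a \<otimes> y"
      by (auto elim: set_mult_memE)
    obtain w where w: "w \<in> lists (X \<times> UNIV)" "length w = k" "word_val G f w = y"
      using Suc.IH[OF ay(2)] by blast
    obtain l where "l \<in> X \<times> UNIV" "letter_val G f l = a"
    proof -
      consider y where "y \<in> X" "a = f y" | y where "y \<in> X" "a = inv (f y)"
        using ay(1) by (auto simp: A_def)
      then show thesis
      proof cases
        case 1 then show thesis by (intro that[of "(y, True)"]) (simp_all add: letter_val_def)
      next
        case 2 then show thesis by (intro that[of "(y, False)"]) (simp_all add: letter_val_def)
      qed
    qed
    then show ?case using w ay(3) by (intro bexI[of _ "l # w"]) auto
  qed (auto intro!: bexI[of _ "[]"])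
  have word_A: "word_val G f w \<in> set_power G A (length w)" if "w \<in> lists (X \<times> UNIV)" for w
    using that
  proof (induction w rule: lists.induct)
    case (Cons a w)
    have "letter_val G f a \<in> A" using Cons(1) by (auto simp: letter_val_def A_def)
    then show ?case using Cons by (auto intro: set_mult_memI)
  qed simp
  have cover: "carrier G \<subseteq> \<Union>(range (set_power G A))"
    using gen word_A by blast
  have closed: "closedin T (set_power G A k)" for k
    using comp Hausdorff by (rule compactin_imp_closedin[rotated])
  have "openin T (carrier G)" using openin_topspace[of T] by simp
  then have "\<exists>C\<in>range (set_power G A). T interior_of C \<noteq> {}"
    using cover closed one_closed by (intro Baire_interior[where A = "carrier G"]) auto
  then obtain k where k: "T interior_of (set_power G A k) \<noteq> {}" by blast
  then obtain x where x: "x \<in> T interior_of (set_power G A k)" by blast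
  have xc: "x \<in> carrier G" using x interior_of_subset_topspace[of T] by auto
  let ?O = "{y \<in> carrier G. x \<otimes> y \<in> T interior_of (set_power G A k)}"
  have "openin T ?O" "\<one> \<in> ?O"
    using x xc by (auto intro!: openin_preimage continuous_map_group_intros)
  then obtain F where F: "finite F" "F \<subseteq> C" "\<And>c. c \<in> C \<Longrightarrow> \<exists>d\<in>F. inv d \<otimes> c \<in> ?O"
    using finite_left_cover[OF C, of ?O] by metis
  have Fc: "F \<subseteq> carrier G" using F(2) compactin_carrierD[OF C] by (rule order_trans)
  \<comment> \<open>In the splitting \<open>c = (d \<otimes> inv x) \<otimes> (x \<otimes> (inv d
    \<otimes> c))\<close> the second factor is the value of a word of length \<open>k\<close>, and
    there are only finitely many first factors.\<close>
  have "\<forall>d\<in>F. \<exists>w\<in>lists (X \<times> UNIV). word_val G f w = d \<otimes> inv x"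
    using Fc xc gen by (metis inv_closed m_closed subsetD)
  then obtain v where v: "\<And>d. d \<in> F \<Longrightarrow> v d \<in> lists (X \<times> UNIV) \<and> word_val G f (v d) = d \<otimes> inv x"
    by metis
  show thesis
  proof (rule that)
    fix c assume c: "c \<in> C"
    obtain d where d: "d \<in> F" "inv d \<otimes> c \<in> ?O" using F(3)[OF c] by blast
    have cc: "c \<in> carrier G" "d \<in> carrier G" using c d(1) Fc compactin_carrierD[OF C] by auto
    have "x \<otimes> (inv d \<otimes> c) \<in> set_power G A k"
      using d(2) interior_of_subset[of T "set_power G A k"] by blast
    then obtain w where w: "w \<in> lists (X \<times> UNIV)" "length w = k" "word_val G f w = x \<otimes> (inv d \<otimes> c)"
      using A_word by blast
    have "length (v d) \<le> Max (length ` v ` F)" using d(1) F(1) by (intro Max_ge) auto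
    moreover have "word_val G f (v d @ w) = c"
      using v[OF d(1)] w xc cc by (simp add: f.word_val_append m_assoc del: in_lists_conv_set)
    ultimately show "\<exists>w\<in>lists (X \<times> UNIV). length w \<le> Max (length ` v ` F) + k \<and> word_val G f w = c"
      using v[OF d(1)] w by (intro bexI[of _ "v d @ w"]) auto
  qed
qed

text \<open>The induction step is \<open>(a g) (b u)^-1 = (a b^-1) (b (g u^-1) b^-1)\<close>: each
  letter contributes one factor from \<open>S\<close>, and the rest is conjugated by
  \<open>b\<close> in \<open>U\<close>, under which \<open>S\<close> is stable.\<close>

lemma word_val_quotient:
  assumes f: "f \<in> X \<rightarrow> carrier G" and \<psi>: "\<psi> \<in> X \<rightarrow> U"
    and S: "S \<subseteq> carrier G" "\<And>u s. u \<in> U \<Longrightarrow> s \<in> S \<Longrightarrow> u \<otimes> s \<otimes> inv u \<in> S"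
      "\<And>s. s \<in> S \<Longrightarrow> inv s \<in> S" "\<And>x. x \<in> X \<Longrightarrow> f x \<otimes> inv (\<psi> x) \<in> S"
    and w: "w \<in> lists (X \<times> UNIV)"
  shows "word_val G \<psi> w \<in> U" "word_val G f w \<otimes> inv (word_val G \<psi> w) \<in> set_power G S (length w)"
proof -
  interpret f: group_map G X f by unfold_locales (rule f)
  have "word_val G \<psi> w \<in> U \<and>
    word_val G f w \<otimes> inv (word_val G \<psi> w) \<in> set_power G S (length w)"
    using w
  proof (induction w rule: lists.induct)
    case (Cons a w)
    obtain x b where a: "a = (x, b)" by (cases a)
    have x: "x \<in> X" using Cons a by simp
    have fx: "f x \<in> carrier G" and \<psi>x: "\<psi> x \<in> U" using x f \<psi> by auto
    let ?a = "letter_val G f a" and ?b = "letter_val G \<psi> a"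
    have ab: "?a \<in> carrier G" "?b \<in> U" using fx \<psi>x by (auto simp: letter_val_def a)
    have "?a \<otimes> inv ?b \<in> S"
    proof (cases b)
      case False
      \<comment> \<open>For an inverse letter, the quotient is the inverse of the quotient at
        \<open>x\<close>, conjugated by \<open>inv (\<psi> x)\<close>.\<close>
      have "inv (f x) \<otimes> inv (inv (\<psi> x)) = inv (\<psi> x) \<otimes> inv (f x \<otimes> inv (\<psi> x)) \<otimes> inv (inv (\<psi> x))"
        using fx \<psi>x by (simp add: inv_mult_group m_assoc)
      then show ?thesis
        using S(2)[OF U.m_inv_closed[OF \<psi>x] S(3)[OF S(4)[OF x]]] False
        by (simp add: a letter_val_def)
    qed (use S(4)[OF x] in \<open>simp add: a letter_val_def\<close>)
    moreover have "?b \<otimes> (word_val G f w \<otimes> inv (word_val G \<psi> w)) \<otimes> inv ?b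
        \<in> set_power G S (length w)"
      using set_power_conj[OF S(1), of ?b] S(2)[OF ab(2)] Cons.IH ab by auto
    moreover have "?a \<otimes> word_val G f w \<otimes> inv (?b \<otimes> word_val G \<psi> w) =
        (?a \<otimes> inv ?b) \<otimes> (?b \<otimes> (word_val G f w \<otimes> inv (word_val G \<psi> w)) \<otimes> inv ?b)"
      using ab Cons.IH f.word_val_closed[OF Cons(2)] by (simp add: inv_mult_group m_assoc)
    ultimately show ?case using ab(2) Cons.IH by (auto intro: set_mult_memI)
  qed simp
  then show "word_val G \<psi> w \<in> U"
    "word_val G f w \<otimes> inv (word_val G \<psi> w) \<in> set_power G S (length w)" by auto
qed

text \<open>The common core of both cases: perfectness will be exploited through \<open>M\<close>,
  \<open>F\<close> and the decomposition \<open>G = M V\<close>, finiteness of the abelianization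
  through \<open>V\<close>.\<close>

lemma central_modulo:
  assumes simple: "topologically_simple G T" and nontriv: "H \<noteq> {\<one>}"
    and presented: "compactly_presented TYPE('x) G T"
  obtains M F V where "M \<lhd> G" "countable F" "F \<subseteq> carrier G" "M \<subseteq> H <#> F"
    "H \<subseteq> M" "subgroup V G" "V \<subseteq> U" "openin T V" "\<And>u v. u \<in> U \<Longrightarrow> v \<in> V \<Longrightarrow> comm u v \<in> H"
    "\<And>g. g \<in> carrier G \<Longrightarrow> \<exists>m\<in>M. \<exists>v\<in>V. g = m \<otimes> v"
proof -
  obtain X :: "'x set" and f n where f: "f \<in> X \<rightarrow> carrier G" "compactin T (f ` X)"
    and gen: "\<And>g. g \<in> carrier G \<Longrightarrow> \<exists>w\<in>lists (X \<times> UNIV). word_val G f w = g"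
    and rel: "\<And>(Q :: ('a, 'b) monoid_scheme) h W. \<lbrakk>group Q; h \<in> X \<rightarrow> carrier Q; W \<lhd> Q;
       \<And>w. w \<in> lists (X \<times> UNIV) \<Longrightarrow> length w \<le> n \<Longrightarrow> word_val G f w = \<one> \<Longrightarrow> word_val Q h w \<in> W\<rbrakk>
       \<Longrightarrow> \<forall>w\<in>lists (X \<times> UNIV). word_val G f w = \<one> \<longrightarrow> word_val Q h w \<in> W"
  proof (rule compactly_presented_words[OF is_group presented], goal_cases)
    case (1 X f n)
    then show thesis by (intro that[of f X n]) auto
  qed
  interpret f: group_map G X f by unfold_locales (rule f)
  obtain \<psi> where \<psi>: "\<psi> \<in> X \<rightarrow> U" and fin: "finite ((\<lambda>x. f x \<otimes> inv (\<psi> x)) ` X)"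
    and germ: "(\<lambda>x. f x \<otimes> inv (\<psi> x)) ` X \<subseteq> germ_centralizer"
    using letters_modulo_U[OF simple nontriv f] by blast
  interpret \<psi>: group_map G X \<psi>
    by unfold_locales (use \<psi> in \<open>simp add: Pi_iff\<close>)
  define P where "P = (\<lambda>x. f x \<otimes> inv (\<psi> x)) ` X"
  \<comment> \<open>Inverses and all \<open>U\<close>-conjugates are included to make
    \<open>S\<close> symmetric and \<open>U\<close>-stable; it is still covered by finitely many
    cosets of \<open>H\<close>.\<close>
  define S where "S = H \<union> (\<Union>p\<in>P \<union> (\<lambda>p. inv p) ` P. (\<lambda>u. u \<otimes> p \<otimes> inv u) ` U)"
  define M where "M = generate G S"

  have P': "p \<in> germ_centralizer" if "p \<in> P \<union> (\<lambda>p. inv p) ` P" for p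
    using that germ unfolding P_def by auto
  have S_memI: "u \<otimes> p \<otimes> inv u \<in> S" if "p \<in> P \<union> (\<lambda>p. inv p) ` P" "u \<in> U" for p u
    unfolding S_def by (rule UnI2, rule UN_I[OF that(1)], rule imageI[OF that(2)])
  have S_K: "S \<subseteq> germ_centralizer"
    using H_subset_germ_centralizer P' K.inv_op_closed2 by (auto simp: S_def)
  have S_carrier: "S \<subseteq> carrier G" using S_K K.subset by (rule order_trans)
  have one_S: "\<one> \<in> S" by (simp add: S_def)
  have S_conj: "u \<otimes> s \<otimes> inv u \<in> S" if u: "u \<in> U" and s: "s \<in> S" for u s
  proof (cases "s \<in> H")
    case False
    then obtain p v where pv: "p \<in> P \<union> (\<lambda>p. inv p) ` P" "v \<in> U" "s = v \<otimes> p \<otimes> inv v"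
      using s by (auto simp: S_def)
    have "u \<otimes> s \<otimes> inv u = (u \<otimes> v) \<otimes> p \<otimes> inv (u \<otimes> v)"
      using u pv(2) P'[OF pv(1)] unfolding pv(3) by (simp add: m_assoc inv_mult_group)
    then show ?thesis using S_memI[OF pv(1), of "u \<otimes> v"] u pv(2) by simp
  qed (use H_conj u in \<open>simp add: S_def\<close>)
  have S_inv: "inv s \<in> S" if s: "s \<in> S" for s
  proof (cases "s \<in> H")
    case False
    then obtain p v where pv: "p \<in> P \<union> (\<lambda>p. inv p) ` P" "v \<in> U" "s = v \<otimes> p \<otimes> inv v"
      using s by (auto simp: S_def)
    have pc: "p \<in> carrier G" using P'[OF pv(1)] by simp
    then have "inv s = v \<otimes> inv p \<otimes> inv v"
      using pv(2) unfolding pv(3) by (simp add: m_assoc inv_mult_group)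
    moreover have "inv p \<in> P \<union> (\<lambda>p. inv p) ` P"
    proof (cases "p \<in> P")
      case False
      then obtain q where q: "q \<in> P" "p = inv q" using pv(1) by blast
      then have "q \<in> carrier G" using P'[of q] by simp
      then show ?thesis using q by simp
    qed blast
    ultimately show ?thesis using S_memI[of "inv p" v] pv(2) by simp
  qed (simp add: S_def)
  have "finite (P \<union> (\<lambda>p. inv p) ` P)" using fin by (simp add: P_def)
  then have "finite_mod H (\<Union>p\<in>P \<union> (\<lambda>p. inv p) ` P. (\<lambda>u. u \<otimes> p \<otimes> inv u) ` U)"
    by (rule finite_mod_UN) (rule finite_mod_conj_germ_centralizer[OF P'])
  moreover have "finite_mod H H"
    unfolding finite_mod_def by (intro exI[of _ "{\<one>}"]) (auto simp: set_mult_def)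
  ultimately have S_fin: "finite_mod H S" unfolding S_def by (intro finite_mod_Un)
  have pow_fin: "finite_mod H (set_power G S k)" for k
    by (rule finite_mod_set_power[OF subgroup_H finite_mod_conj_H S_fin])
  have pow_K: "set_power G S k \<subseteq> germ_centralizer" for k
    by (rule set_power_subset_subgroup[OF K.is_subgroup S_K])
  have M_eq: "M = (\<Union>k. set_power G S k)"
    unfolding M_def by (rule generate_eq_Union_set_power[OF S_carrier S_inv])

  have S_letter: "f x \<otimes> inv (\<psi> x) \<in> S" if x: "x \<in> X" for x
  proof -
    have "f x \<otimes> inv (\<psi> x) \<in> P" using x by (simp add: P_def)
    moreover from this have "f x \<otimes> inv (\<psi> x) = \<one> \<otimes> (f x \<otimes> inv (\<psi> x)) \<otimes> inv \<one>"
      using P' by simp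
    ultimately show ?thesis using S_memI[OF _ U.one_closed] by (metis UnI1)
  qed
  have \<psi>_U: "word_val G \<psi> w \<in> U"
    and quot: "word_val G f w \<otimes> inv (word_val G \<psi> w) \<in> set_power G S (length w)"
    if "w \<in> lists (X \<times> UNIV)" for w
    using word_val_quotient[OF f(1) \<psi> S_carrier S_conj S_inv S_letter that] by blast+

  interpret M: subgroup M G
    unfolding M_def by (rule generate_is_subgroup[OF S_carrier])
  have M_conj: "u \<otimes> m \<otimes> inv u \<in> M" if u: "u \<in> U" and m: "m \<in> M" for u m
  proof -
    obtain k where "m \<in> set_power G S k" using m unfolding M_eq by blast
    then have "u \<otimes> m \<otimes> inv u \<in> set_power G S k"
      using set_power_conj[OF S_carrier, of u m k] S_conj[OF u] u by simp
    then show ?thesis unfolding M_eq by blast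
  qed
  \<comment> \<open>A word for \<open>g\<close> has its \<open>\<psi>\<close>-value in
    \<open>U\<close>, and the two values differ by an element of \<open>M\<close>.\<close>
  have MU: "\<exists>m\<in>M. \<exists>u\<in>U. g = m \<otimes> u" if g: "g \<in> carrier G" for g
  proof -
    obtain w where w: "w \<in> lists (X \<times> UNIV)" "word_val G f w = g" using gen[OF g] by blast
    have "g = (g \<otimes> inv (word_val G \<psi> w)) \<otimes> word_val G \<psi> w"
      using \<psi>_U[OF w(1)] g by (simp add: m_assoc)
    then show ?thesis using quot[OF w(1)] \<psi>_U[OF w(1)] w(2) unfolding M_eq by blast
  qed
  \<comment> \<open>Both factors in \<open>G = M U\<close> normalise \<open>M\<close>.\<close>
  have M_normal: "M \<lhd> G"
  proof (rule normal_invI)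
    fix g x assume g: "g \<in> carrier G" and x: "x \<in> M"
    obtain m u where mu: "m \<in> M" "u \<in> U" "g = m \<otimes> u" using MU[OF g] by blast
    have "g \<otimes> x \<otimes> inv g = m \<otimes> (u \<otimes> x \<otimes> inv u) \<otimes> inv m"
      using mu x by (simp add: m_assoc inv_mult_group)
    then show "g \<otimes> x \<otimes> inv g \<in> M" using M_conj[OF mu(2) x] mu(1) by simp
  qed (rule M.subgroup_axioms)
  have H_M: "H \<subseteq> M"
    unfolding M_def by (intro subsetI generate.incl) (simp add: S_def)

  obtain L where L: "\<And>u. u \<in> U \<Longrightarrow> \<exists>w\<in>lists (X \<times> UNIV). length w \<le> L \<and> word_val G f w = u"
    using bounded_word_lengths[OF f gen compact_U] by metis
  \<comment> \<open>Words of length at most \<open>L\<close> reach every element of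
    \<open>U\<close>, and length at most \<open>n\<close> is what the presentation requires. For
    both kinds of words, the quotients of the two values lie in \<open>Y\<close> as soon as the
    value in \<open>G\<close> lies in \<open>U\<close>.\<close>
  define Y where "Y = U \<inter> set_power G S (max L n)"
  define V where "V = centralizer_mod Y"
  \<comment> \<open>The aim is \<open>M \<inter> U \<subseteq> W\<close>. By symmetry of
    centralising, \<open>W\<close> contains \<open>Y\<close>; moreover it is normal in
    \<open>U\<close>, as the presentation argument requires.\<close>
  define W where "W = M \<inter> centralizer_mod V"
  have Y_U: "Y \<subseteq> U" by (simp add: Y_def)
  have Y_conj: "u \<otimes> y \<otimes> inv u \<in> Y" if "u \<in> U" "y \<in> Y" for u y
    using that set_power_conj[OF S_carrier, of u y] S_conj[OF that(1)] by (simp add: Y_def)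
  have V_U: "V \<subseteq> U" by (auto simp: V_def centralizer_mod_def)
  have V_open: "openin T V"
    unfolding V_def
  proof (rule openin_centralizer_mod[OF Y_U])
    show "Y \<subseteq> germ_centralizer" using pow_K unfolding Y_def by blast
    show "finite_mod H Y" unfolding Y_def by (rule finite_mod_subset[OF pow_fin Int_lower2])
  qed
  have V_sub: "subgroup V G" unfolding V_def by (rule centralizer_mod_subgroup[OF Y_U])
  have V_conj: "u \<otimes> v \<otimes> inv u \<in> V" if "u \<in> U" "v \<in> V" for u v
    using centralizer_mod_conj[OF Y_U Y_conj] that unfolding V_def by blast
  interpret W: subgroup W G
    unfolding W_def by (rule subgroups_Inter_pair[OF M.subgroup_axioms centralizer_mod_subgroup[OF V_U]])
  have W_U: "W \<subseteq> U" by (auto simp: W_def centralizer_mod_def)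
  have W_conj: "u \<otimes> w \<otimes> inv u \<in> W" if "u \<in> U" "w \<in> W" for u w
    using centralizer_mod_conj[OF V_U V_conj] M_conj that unfolding W_def by blast
  have Y_W: "Y \<subseteq> W"
  proof -
    have "Y \<subseteq> centralizer_mod V"
      by (rule centralizer_mod_symmetric[OF Y_U]) (simp add: V_def)
    moreover have "Y \<subseteq> M" unfolding Y_def M_eq by blast
    ultimately show ?thesis by (simp add: W_def)
  qed
  have short: "word_val G f w \<otimes> inv (word_val G \<psi> w) \<in> W"
    if "w \<in> lists (X \<times> UNIV)" "length w \<le> max L n" "word_val G f w \<in> U" for w
  proof -
    have "word_val G f w \<otimes> inv (word_val G \<psi> w) \<in> set_power G S (max L n)"
      using quot[OF that(1)] set_power_mono[OF S_carrier one_S that(2)] by blast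
    then show ?thesis using \<psi>_U[OF that(1)] that(3) Y_W by (auto simp: Y_def)
  qed

  \<comment> \<open>Here compact presentability enters, with \<open>\<psi>\<close> as a map into the
    group \<open>U\<close> and its normal subgroup \<open>W\<close>. For words of length at most
    \<open>n\<close> the claim follows from \<open>short\<close>.\<close>
  have relators: "word_val G \<psi> w \<in> W"
    if w: "w \<in> lists (X \<times> UNIV)" "word_val G f w = \<one>" for w
  proof -
    let ?Q = "G\<lparr>carrier := U\<rparr>"
    have Q: "group ?Q" by (rule subgroup_imp_group[OF U.subgroup_axioms])
    have "W \<lhd> ?Q"
    proof (rule group.normal_invI[OF Q])
      show "subgroup W ?Q"
        by (rule subgroup_incl[OF W.subgroup_axioms U.subgroup_axioms W_U])
    qed (use W_conj m_inv_consistent[OF U.subgroup_axioms] in simp)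
    moreover have "word_val ?Q \<psi> w \<in> W"
      if "w \<in> lists (X \<times> UNIV)" "length w \<le> n" "word_val G f w = \<one>" for w
    proof -
      have "inv (word_val G \<psi> w) \<in> W" using short[of w] that \<psi>_U[OF that(1)] by simp
      then have "inv (inv (word_val G \<psi> w)) \<in> W" by (rule W.m_inv_closed)
      then show ?thesis
        using word_val_subgroup[OF U.subgroup_axioms \<psi> that(1)] \<psi>_U[OF that(1)] by simp
    qed
    ultimately have "word_val ?Q \<psi> w \<in> W" using rel[OF Q, of \<psi> W] \<psi> w by simp
    then show ?thesis using word_val_subgroup[OF U.subgroup_axioms \<psi> w(1)] by simp
  qed

  \<comment> \<open>By the choice of \<open>L\<close>, a word for \<open>u\<close> can be taken
    short enough for \<open>short\<close>.\<close>
  have lift: "\<exists>w\<in>lists (X \<times> UNIV). word_val G f w = u \<and> u \<otimes> inv (word_val G \<psi> w) \<in> W"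
    if u: "u \<in> U" for u
  proof -
    obtain w where w: "w \<in> lists (X \<times> UNIV)" "length w \<le> L" "word_val G f w = u"
      using L[OF u] by blast
    show ?thesis using w u short[of w] by (intro bexI[of _ w]) auto
  qed

  \<comment> \<open>\<open>E\<close> is closed under products and inverses. Once it contains
    \<open>S\<close>, every element of \<open>M\<close> is the value of a word that
    \<open>\<psi>\<close> sends into \<open>W\<close>.\<close>
  define E where "E = {word_val G f w | w. w \<in> lists (X \<times> UNIV) \<and> word_val G \<psi> w \<in> W}"
  have E_mult: "x \<otimes> y \<in> E" if x: "x \<in> E" and y: "y \<in> E" for x y
  proof -
    obtain v w where "v \<in> lists (X \<times> UNIV)" "word_val G \<psi> v \<in> W" "x = word_val G f v"
      "w \<in> lists (X \<times> UNIV)" "word_val G \<psi> w \<in> W" "y = word_val G f w"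
      using x y unfolding E_def by blast
    then show ?thesis unfolding E_def
      by (intro CollectI exI[of _ "v @ w"])
        (simp add: f.word_val_append \<psi>.word_val_append del: in_lists_conv_set)
  qed
  have E_inv: "inv x \<in> E" if x: "x \<in> E" for x
  proof -
    obtain w where "w \<in> lists (X \<times> UNIV)" "word_val G \<psi> w \<in> W" "x = word_val G f w"
      using x unfolding E_def by blast
    then show ?thesis unfolding E_def
      by (intro CollectI exI[of _ "rev (map inv_letter w)"])
        (simp add: f.word_val_inv \<psi>.word_val_inv f.inv_word_in_words del: in_lists_conv_set)
  qed
  \<comment> \<open>\<open>H\<close> is normal in \<open>U\<close>, so its commutators with
    \<open>V\<close> lie in \<open>H\<close>. Hence \<open>H \<subseteq> W\<close>, and the word
    from \<open>lift\<close> has its \<open>\<psi>\<close>-value in \<open>W\<close> as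
    well.\<close>
  have E_H: "h \<in> E" if h: "h \<in> H" for h
  proof -
    have hU: "h \<in> U" using h H_subset by blast
    obtain w where w: "w \<in> lists (X \<times> UNIV)" "word_val G f w = h" "h \<otimes> inv (word_val G \<psi> w) \<in> W"
      using lift[OF hU] by blast
    have "comm h v \<in> H" if v: "v \<in> V" for v
    proof -
      have vU: "v \<in> U" using v V_U by blast
      have "comm h v = h \<otimes> (v \<otimes> inv h \<otimes> inv v)"
        using h vU by (simp add: m_assoc)
      then show ?thesis using H_conj[OF vU H.m_inv_closed[OF h]] h by simp
    qed
    then have hW: "h \<in> W" using hU h H_M by (auto simp: W_def centralizer_mod_def)
    have "word_val G \<psi> w = inv (h \<otimes> inv (word_val G \<psi> w)) \<otimes> h"
      using \<psi>_U[OF w(1)] hU by (simp add: inv_mult_group m_assoc)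
    then have "word_val G \<psi> w \<in> W" using w(3) hW by (metis W.m_closed W.m_inv_closed)
    then show ?thesis using w unfolding E_def by blast
  qed
  have E_P: "u \<otimes> p \<otimes> inv u \<in> E" if u: "u \<in> U" and p: "p \<in> P" for u p
  proof -
    obtain x where x: "x \<in> X" "p = f x \<otimes> inv (\<psi> x)" using p by (auto simp: P_def)
    have fx: "f x \<in> carrier G" and \<psi>x: "\<psi> x \<in> U" using x(1) f(1) \<psi> by auto
    obtain v where v: "v \<in> lists (X \<times> UNIV)" "word_val G f v = u"
      using gen[of u] u by auto
    obtain w where w: "w \<in> lists (X \<times> UNIV)" "word_val G f w = \<psi> x" "\<psi> x \<otimes> inv (word_val G \<psi> w) \<in> W"
      using lift[OF \<psi>x] by blast
    have x_word: "[(x, True)] \<in> lists (X \<times> UNIV)" using x(1) by simp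
    \<comment> \<open>The word spells \<open>u f(x) \<psi>(x)^-1 u^-1\<close>, with \<open>w\<close>
      lifting \<open>\<psi> x\<close>. Its \<open>\<psi>\<close>-value is a
      \<open>U\<close>-conjugate of \<open>\<psi> x \<otimes> inv (word_val G \<psi> w)\<close>,
      which lies in \<open>W\<close>.\<close>
    let ?w = "v @ [(x, True)] @ rev (map inv_letter w) @ rev (map inv_letter v)"
    have words: "?w \<in> lists (X \<times> UNIV)"
      using v(1) w(1) x_word f.inv_word_in_words by (metis append_in_lists_conv)
    have val: "word_val G g ?w = word_val G g v \<otimes> (g x \<otimes> inv (word_val G g w)) \<otimes> inv (word_val G g v)"
      if g: "g \<in> X \<rightarrow> carrier G" for g
    proof -
      interpret g: group_map G X g by unfold_locales (rule g)
      have "g x \<in> carrier G" using g x(1) by auto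
      moreover have "rev (map inv_letter w) @ rev (map inv_letter v) \<in> lists (X \<times> UNIV)"
        using v(1) w(1) f.inv_word_in_words by (metis append_in_lists_conv)
      ultimately show ?thesis
        using v(1) w(1) x_word f.inv_word_in_words[OF v(1)] f.inv_word_in_words[OF w(1)]
          g.word_val_closed[OF v(1)] g.word_val_closed[OF w(1)] words
        by (simp add: g.word_val_append g.word_val_inv letter_val_def m_assoc del: in_lists_conv_set)
    qed
    have "word_val G f ?w = u \<otimes> p \<otimes> inv u"
      using val[OF f(1)] v(2) w(2) x(2) by simp
    moreover have "word_val G \<psi> ?w \<in> W"
      using val[OF \<psi>.map_closed] W_conj[OF \<psi>_U[OF v(1)] w(3)] by simp
    then have "word_val G f ?w \<in> E"
      unfolding E_def by (intro CollectI exI[of _ ?w] conjI refl words)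
    ultimately show ?thesis by (simp only:)
  qed
  have "S \<subseteq> E"
  proof
    fix s assume s: "s \<in> S"
    show "s \<in> E"
    proof (cases "s \<in> H")
      case False
      then obtain p u where pu: "p \<in> P \<union> (\<lambda>p. inv p) ` P" "u \<in> U" "s = u \<otimes> p \<otimes> inv u"
        using s by (auto simp: S_def)
      show ?thesis
      proof (cases "p \<in> P")
        case False
        then obtain q where q: "q \<in> P" "p = inv q" using pu(1) by blast
        have "q \<in> carrier G" using P'[of q] q(1) by simp
        then have "s = inv (u \<otimes> q \<otimes> inv u)"
          using pu(2) unfolding pu(3) q(2) by (simp add: inv_mult_group m_assoc)
        then show ?thesis using E_inv[OF E_P[OF pu(2) q(1)]] by simp
      qed (use E_P pu in blast)
    qed (rule E_H)
  qed
  have M_E: "m \<in> E" if "m \<in> M" for m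
    using that unfolding M_def
  proof induction
    case one
    show ?case using E_H[OF H.one_closed] .
  next
    case (inv h)
    then show ?case using E_inv \<open>S \<subseteq> E\<close> by blast
  qed (use \<open>S \<subseteq> E\<close> E_mult in blast)+

  \<comment> \<open>Two words for \<open>x\<close> are compared: \<open>v\<close> with
    \<open>\<psi>\<close>-value in \<open>W\<close>, and \<open>w\<close> from \<open>lift\<close>.
    As \<open>v w^-1\<close> is a relator, their \<open>\<psi>\<close>-values agree modulo
    \<open>W\<close>; hence that of \<open>w\<close> lies in \<open>W\<close>, and so does
    \<open>x\<close>.\<close>
  have MU_W: "x \<in> W" if x: "x \<in> M" "x \<in> U" for x
  proof -
    obtain v where v: "v \<in> lists (X \<times> UNIV)" "word_val G \<psi> v \<in> W" "x = word_val G f v"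
      using M_E[OF x(1)] unfolding E_def by blast
    obtain w where w: "w \<in> lists (X \<times> UNIV)" "word_val G f w = x" "x \<otimes> inv (word_val G \<psi> w) \<in> W"
      using lift[OF x(2)] by blast
    have iw: "rev (map inv_letter w) \<in> lists (X \<times> UNIV)" by (rule f.inv_word_in_words[OF w(1)])
    have "word_val G \<psi> (v @ rev (map inv_letter w)) \<in> W"
    proof (rule relators)
      show "v @ rev (map inv_letter w) \<in> lists (X \<times> UNIV)" using v(1) iw by (metis append_in_lists_conv)
      show "word_val G f (v @ rev (map inv_letter w)) = \<one>"
        using v iw w x(2) by (simp add: f.word_val_append f.word_val_inv del: in_lists_conv_set)
    qed
    then have vw: "word_val G \<psi> v \<otimes> inv (word_val G \<psi> w) \<in> W"
      using v(1) iw w(1) by (simp add: \<psi>.word_val_append \<psi>.word_val_inv del: in_lists_conv_set)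
    have "x = (x \<otimes> inv (word_val G \<psi> w)) \<otimes> (inv (word_val G \<psi> v \<otimes> inv (word_val G \<psi> w)) \<otimes> word_val G \<psi> v)"
      using x(2) \<psi>_U[OF v(1)] \<psi>_U[OF w(1)] by (simp add: inv_mult_group m_assoc)
    then show ?thesis
      using w(3) vw v(2) by (metis W.m_closed W.m_inv_closed)
  qed

  obtain h where h: "h \<in> M" "h \<noteq> \<one>" using nontriv H.one_closed H_M by blast
  \<comment> \<open>Since \<open>H\<close> is closed, a failure at \<open>u\<close> would persist on
    an open subset of \<open>U\<close>. The dense subgroup \<open>M\<close> meets this set,
    contradicting \<open>MU_W\<close>.\<close>
  have central: "comm u v \<in> H" if u: "u \<in> U" and v: "v \<in> V" for u v
  proof (rule ccontr)
    assume not: "comm u v \<notin> H"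
    have vU: "v \<in> U" using v V_U by blast
    let ?A = "U \<inter> {x \<in> carrier G. comm x v \<in> carrier G - H}"
    have "openin T (carrier G - H)" using closed_H by (simp add: closedin_def)
    then have "openin T ?A"
      using vU open_U by (intro openin_Int openin_preimage continuous_map_group_intros) auto
    moreover have "u \<in> ?A" using u not vU by simp
    ultimately obtain x where "x \<in> M" "x \<in> U" "comm x v \<notin> H"
      using dense_normal_subgroup[OF simple M_normal h, of ?A] by blast
    then show False using MU_W[of x] v by (auto simp: W_def centralizer_mod_def)
  qed
  \<comment> \<open>Below, \<open>?A\<close> is the open coset \<open>g V\<close>, which the dense
    subgroup \<open>M\<close> meets.\<close>
  have MV: "\<exists>m\<in>M. \<exists>v\<in>V. g = m \<otimes> v" if g: "g \<in> carrier G" for g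
  proof -
    let ?A = "{x \<in> carrier G. inv x \<otimes> g \<in> V}"
    have "openin T ?A" using g V_open by (intro openin_preimage continuous_map_group_intros) auto
    moreover have "g \<in> ?A" using g subgroup.one_closed[OF V_sub] by simp
    ultimately obtain m where m: "m \<in> M" "inv m \<otimes> g \<in> V"
      using dense_normal_subgroup[OF simple M_normal h, of ?A] by blast
    have "g = m \<otimes> (inv m \<otimes> g)" using m(1) g by simp
    then show ?thesis using m by blast
  qed
  have "\<forall>k. \<exists>F. finite F \<and> F \<subseteq> carrier G \<and> set_power G S k \<subseteq> H <#> F"
    using pow_fin unfolding finite_mod_def by blast
  then obtain F where F: "\<And>k. finite (F k) \<and> F k \<subseteq> carrier G \<and> set_power G S k \<subseteq> H <#> F k"
    by metis
  have M_F: "M \<subseteq> H <#> (\<Union>k. F k)"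
  proof
    fix m assume "m \<in> M"
    then obtain k where "m \<in> H <#> F k" using F unfolding M_eq by blast
    then show "m \<in> H <#> (\<Union>k. F k)" by (auto simp: set_mult_def)
  qed
  show thesis
  proof (rule that[OF M_normal _ _ M_F H_M V_sub V_U V_open central MV])
    show "countable (\<Union>k. F k)" using F by (intro countable_UN) (auto intro: countable_finite)
    show "(\<Union>k. F k) \<subseteq> carrier G" using F by blast
  qed
qed

end

section \<open>Schur's theorem\<close>

text \<open>Lists keep the factors visible, so that occurrences of one factor can be counted and
  products shortened.\<close>

definition (in monoid) list_product :: "'a list \<Rightarrow> 'a" where
  "list_product xs = foldr (\<otimes>) xs \<one>"

context group
begin

lemma list_product_simps [simp]:
  "list_product [] = \<one>" "list_product (x # xs) = x \<otimes> list_product xs"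
  by (simp_all add: list_product_def)

lemma list_product_closed [simp]: "set xs \<subseteq> carrier G \<Longrightarrow> list_product xs \<in> carrier G"
  by (induction xs) auto

lemma list_product_append:
  "set xs \<subseteq> carrier G \<Longrightarrow> set ys \<subseteq> carrier G \<Longrightarrow>
    list_product (xs @ ys) = list_product xs \<otimes> list_product ys"
  by (induction xs) (auto simp: m_assoc)

lemma list_product_replicate: "x \<in> carrier G \<Longrightarrow> list_product (replicate n x) = x [^] n"
  by (induction n) (auto simp: nat_pow_Suc2[symmetric])

text \<open>Occurrences of \<open>c\<close> are moved to the front; the factors they pass are
  replaced by conjugates, which stay in \<open>D\<close>.\<close>

lemma list_product_extract:
  assumes D: "D \<subseteq> carrier G" "\<And>d g. d \<in> D \<Longrightarrow> g \<in> carrier G \<Longrightarrow> g \<otimes> d \<otimes> inv g \<in> D"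
    and "set xs \<subseteq> D" "c \<in> D" "m \<le> count_list xs c"
  shows "\<exists>ys. set ys \<subseteq> D \<and> length ys + m = length xs \<and> list_product xs = c [^] m \<otimes> list_product ys"
  using assms(3,5)
proof (induction xs arbitrary: m)
  case Nil
  then show ?case by auto
next
  case (Cons x xs)
  have c: "c \<in> carrier G" and x: "x \<in> carrier G" and xs: "set xs \<subseteq> carrier G"
    using Cons.prems D assms(4) by auto
  show ?case
  proof (cases m)
    case 0
    then show ?thesis
      using Cons.prems x xs by (intro exI[of _ "x # xs"]) auto
  next
    case (Suc k)
    show ?thesis
    proof (cases "x = c")
      case True
      then obtain ys where ys: "set ys \<subseteq> D" "length ys + k = length xs"
          "list_product xs = c [^] k \<otimes> list_product ys"
        using Cons.IH[of k] Cons.prems Suc by auto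
      have "set ys \<subseteq> carrier G" using ys(1) D(1) by auto
      then have "list_product (x # xs) = c [^] m \<otimes> list_product ys"
        using ys(3) c True Suc by (simp add: nat_pow_Suc2[symmetric] m_assoc[symmetric] del: nat_pow_Suc)
      then show ?thesis using ys Suc by (intro exI[of _ ys]) auto
    next
      case False
      then obtain ys where ys: "set ys \<subseteq> D" "length ys + m = length xs"
          "list_product xs = c [^] m \<otimes> list_product ys"
        using Cons.IH[of m] Cons.prems by auto
      let ?x = "inv (c [^] m) \<otimes> x \<otimes> inv (inv (c [^] m))"
      have "?x \<in> D" using D(2)[of x "inv (c [^] m)"] Cons.prems c by simp
      moreover have "set ys \<subseteq> carrier G" using ys(1) D(1) by auto
      then have "list_product (x # xs) = c [^] m \<otimes> list_product (?x # ys)"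
        using ys(3) c x by (simp add: m_assoc)
      ultimately show ?thesis using ys by (intro exI[of _ "?x # ys"]) auto
    qed
  qed
qed

text \<open>By the pigeonhole principle, a list longer than \<open>n * card D\<close> contains some
  \<open>c\<close> at least \<open>n + 1\<close> times. Collecting \<open>n + 1\<close> of them and
  rewriting their product with \<open>n\<close> factors shortens the list by one.\<close>

lemma list_product_shorten:
  assumes D: "D \<subseteq> carrier G" "\<And>d g. d \<in> D \<Longrightarrow> g \<in> carrier G \<Longrightarrow> g \<otimes> d \<otimes> inv g \<in> D" "finite D"
    and pow: "\<And>d. d \<in> D \<Longrightarrow> \<exists>zs. set zs \<subseteq> D \<and> length zs = n \<and> d [^] Suc n = list_product zs"
    and "set xs \<subseteq> D"
  shows "\<exists>ys. set ys \<subseteq> D \<and> length ys \<le> n * card D \<and> list_product ys = list_product xs"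
  using assms(5)
proof (induction "length xs" arbitrary: xs rule: less_induct)
  case less
  show ?case
  proof (cases "length xs \<le> n * card D")
    case False
    have "length xs = sum (count_list xs) D"
      using sum_count_set[OF less.prems D(3)] by simp
    moreover have "sum (count_list xs) D \<le> card D * n" if "\<forall>c\<in>D. count_list xs c \<le> n"
      using sum_bounded_above[of D "count_list xs" n] that by auto
    ultimately obtain c where c: "c \<in> D" "Suc n \<le> count_list xs c"
      using False by (force simp: mult.commute not_le Suc_le_eq)
    obtain ys where ys: "set ys \<subseteq> D" "length ys + Suc n = length xs"
        "list_product xs = c [^] Suc n \<otimes> list_product ys"
      using list_product_extract[OF D(1,2) less.prems c] by blast
    obtain zs where zs: "set zs \<subseteq> D" "length zs = n" "c [^] Suc n = list_product zs"
      using pow[OF c(1)] by blast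
    have "list_product (zs @ ys) = list_product xs"
      using ys zs D(1) by (subst list_product_append) auto
    moreover have "length (zs @ ys) < length xs" "set (zs @ ys) \<subseteq> D" using ys zs by auto
    ultimately show ?thesis using less.hyps by metis
  qed (use less.prems in auto)
qed

text \<open>Commutators depend only on the \<open>Z\<close>-cosets of their entries, so there are
  finitely many. Since \<open>n\<close>-th powers are central for \<open>n\<close> the index of
  \<open>Z\<close>, products of commutators can be shortened to bounded length, and only finitely
  many such lists exist.\<close>

theorem Schur_finite_derived:
  assumes Z: "subgroup Z G" "\<And>z g. z \<in> Z \<Longrightarrow> g \<in> carrier G \<Longrightarrow> z \<otimes> g = g \<otimes> z"
    and fin: "finite (rcosets Z)"
  shows "finite (derived G (carrier G))"
proof -
  interpret Z: subgroup Z G by fact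
  have "Z \<lhd> G"
  proof (rule normal_invI[OF Z(1)])
    fix g z assume gz: "g \<in> carrier G" "z \<in> Z"
    then have "g \<otimes> z \<otimes> inv g = z \<otimes> g \<otimes> inv g" using Z(2)[of z g] by simp
    also have "\<dots> = z" using gz by (simp add: m_assoc)
    finally show "g \<otimes> z \<otimes> inv g \<in> Z" using gz by simp
  qed
  then interpret Z: normal Z G .
  interpret Q: group "G Mod Z" by (rule Z.factorgroup_is_group)
  define n where "n = order (G Mod Z)"
  have "n > 0"
    unfolding n_def using Q.order_gt_0_iff_finite fin by (simp add: FactGroup_def)
  \<comment> \<open>Lagrange's theorem in the quotient of order \<open>n\<close>.\<close>
  have pow_Z: "g [^] n \<in> Z" if g: "g \<in> carrier G" for g
  proof -
    have "Z #> g \<in> carrier (G Mod Z)" using g by (auto simp: carrier_FactGroup)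
    then have "Z #> (g [^] n) = Z"
      using Q.pow_order_eq_1[of "Z #> g"] Z.FactGroup_pow[OF g, of n] unfolding n_def by simp
    then show ?thesis using rcos_self[OF nat_pow_closed[OF g] Z(1), of n] by simp
  qed
  define D where "D = derived_set G (carrier G)"
  let ?comm = "\<lambda>a b. a \<otimes> b \<otimes> inv a \<otimes> inv b"
  have D_memI: "?comm a b \<in> D" if "a \<in> carrier G" "b \<in> carrier G" for a b
    using that unfolding D_def by blast
  have D_memE: "\<exists>a\<in>carrier G. \<exists>b\<in>carrier G. d = ?comm a b" if "d \<in> D" for d
    using that unfolding D_def by blast
  have D_carrier: "D \<subseteq> carrier G"
    unfolding D_def by (rule derived_set_in_carrier) simp
  have D_conj: "g \<otimes> d \<otimes> inv g \<in> D" if d: "d \<in> D" and g: "g \<in> carrier G" for d g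
  proof -
    obtain a b where ab: "a \<in> carrier G" "b \<in> carrier G" "d = ?comm a b" using D_memE[OF d] by blast
    have "g \<otimes> d \<otimes> inv g = ?comm (g \<otimes> a \<otimes> inv g) (g \<otimes> b \<otimes> inv g)"
      using ab(1,2) g unfolding ab(3) by (simp add: m_assoc inv_mult_group)
    then show ?thesis using D_memI ab g by simp
  qed
  have D_inv: "inv d \<in> D" if d: "d \<in> D" for d
  proof -
    obtain a b where ab: "a \<in> carrier G" "b \<in> carrier G" "d = ?comm a b" using D_memE[OF d] by blast
    have "inv d = ?comm b a" using ab(1,2) unfolding ab(3) by (simp add: m_assoc inv_mult_group)
    then show ?thesis using D_memI ab by simp
  qed
  have coset: "\<exists>z\<in>Z. g = z \<otimes> (SOME x. x \<in> Z #> g)" "(SOME x. x \<in> Z #> g) \<in> carrier G"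
    if g: "g \<in> carrier G" for g
  proof -
    have "(SOME x. x \<in> Z #> g) \<in> Z #> g" using rcos_self[OF g Z(1)] by (rule someI)
    then obtain z where z: "z \<in> Z" "(SOME x. x \<in> Z #> g) = z \<otimes> g" by (auto simp: r_coset_def)
    then show "(SOME x. x \<in> Z #> g) \<in> carrier G" using g by simp
    have "g = inv z \<otimes> (SOME x. x \<in> Z #> g)" unfolding z(2) using z(1) g by simp
    then show "\<exists>z\<in>Z. g = z \<otimes> (SOME x. x \<in> Z #> g)" using z(1) by blast
  qed
  \<comment> \<open>\<open>SOME\<close> fixes one representative per coset; passing to it changes an
    entry by a central factor, which cancels in the commutator.\<close>
  have "D \<subseteq> (\<lambda>(A, B). ?comm (SOME x. x \<in> A) (SOME x. x \<in> B)) ` ((rcosets Z) \<times> (rcosets Z))"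
  proof
    fix d assume "d \<in> D"
    then obtain a b where ab: "a \<in> carrier G" "b \<in> carrier G" "d = ?comm a b" using D_memE by blast
    obtain y z where yz: "y \<in> Z" "a = y \<otimes> (SOME x. x \<in> Z #> a)" "z \<in> Z" "b = z \<otimes> (SOME x. x \<in> Z #> b)"
      using coset(1) ab by metis
    have central: "?comm (y \<otimes> a') (z \<otimes> b') = ?comm a' b'"
      if ab': "a' \<in> carrier G" "b' \<in> carrier G" for a' b'
    proof -
      have "?comm (y \<otimes> a') (z \<otimes> b') = y \<otimes> (a' \<otimes> z) \<otimes> b' \<otimes> inv a' \<otimes> (inv y \<otimes> inv b') \<otimes> inv z"
        using ab' yz(1,3) by (simp add: m_assoc inv_mult_group)
      also have "\<dots> = y \<otimes> (z \<otimes> (a' \<otimes> b' \<otimes> inv a' \<otimes> inv b')) \<otimes> inv y \<otimes> inv z"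
        unfolding Z(2)[OF yz(3) ab'(1), symmetric]
          Z(2)[OF Z.m_inv_closed[OF yz(1)] inv_closed[OF ab'(2)]]
        using ab' yz(1,3) by (simp add: m_assoc)
      also have "\<dots> = y \<otimes> ?comm a' b' \<otimes> z \<otimes> inv y \<otimes> inv z"
        by (subst Z(2)[OF yz(3)]) (use ab' yz(1,3) in \<open>simp_all add: m_assoc\<close>)
      also have "\<dots> = ?comm a' b' \<otimes> y \<otimes> (z \<otimes> inv y) \<otimes> inv z"
        by (subst Z(2)[OF yz(1)]) (use ab' yz(1,3) in \<open>simp_all add: m_assoc\<close>)
      also have "\<dots> = ?comm a' b'"
        by (subst Z(2)[OF yz(3)]) (use ab' yz(1,3) in \<open>simp_all add: m_assoc\<close>)
      finally show ?thesis .
    qed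
    have "d = ?comm (SOME x. x \<in> Z #> a) (SOME x. x \<in> Z #> b)"
      using central[OF coset(2)[OF ab(1)] coset(2)[OF ab(2)]] ab(3) yz(2,4) by metis
    then show "d \<in> (\<lambda>(A, B). ?comm (SOME x. x \<in> A) (SOME x. x \<in> B)) ` ((rcosets Z) \<times> (rcosets Z))"
      using ab rcosetsI[OF Z.subset] by (intro image_eqI[of _ _ "(Z #> a, Z #> b)"]) auto
  qed
  then have D_fin: "finite D" using fin finite_subset by blast
  text \<open>As \<open>[a, b]\<^sup>n\<close> is central, \<open>[a, b]\<^sup>n\<^sup>+\<^sup>1 = [a, b\<^sup>2] (b [a, b] b\<inverse>)\<^sup>n\<^sup>-\<^sup>1\<close>.\<close>
  have pow: "\<exists>zs. set zs \<subseteq> D \<and> length zs = n \<and> d [^] Suc n = list_product zs" if d: "d \<in> D" for d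
  proof -
    obtain a b where ab: "a \<in> carrier G" "b \<in> carrier G" "d = ?comm a b" using D_memE[OF d] by blast
    have dc: "d \<in> carrier G" using d D_carrier by blast
    obtain k where k: "n = Suc k" using \<open>n > 0\<close> gr0_implies_Suc by blast
    have conj_pow: "(b \<otimes> d \<otimes> inv b) [^] j = b \<otimes> d [^] j \<otimes> inv b" for j :: nat
      by (induction j) (use ab(2) dc in \<open>simp_all add: m_assoc\<close>)
    have "d [^] Suc n = d \<otimes> d [^] n" using dc by (rule nat_pow_Suc2)
    also have "\<dots> = a \<otimes> b \<otimes> inv a \<otimes> (inv b \<otimes> d [^] n)"
      using ab(1,2) dc by (subst ab(3)) (simp add: m_assoc)
    also have "inv b \<otimes> d [^] n = d [^] n \<otimes> inv b"
      using Z(2)[OF pow_Z[OF dc], of "inv b"] ab(2) by simp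
    also have "d [^] n = d \<otimes> d [^] k" unfolding k using dc by (rule nat_pow_Suc2)
    also have "a \<otimes> b \<otimes> inv a \<otimes> (d \<otimes> d [^] k \<otimes> inv b) =
        ?comm a (b \<otimes> b) \<otimes> (b \<otimes> d [^] k \<otimes> inv b)"
    proof -
      have "inv a \<otimes> d = b \<otimes> inv a \<otimes> inv b" unfolding ab(3) using ab(1,2) by (simp add: m_assoc)
      then have "a \<otimes> b \<otimes> inv a \<otimes> (d \<otimes> d [^] k \<otimes> inv b) = a \<otimes> b \<otimes> (b \<otimes> inv a \<otimes> inv b) \<otimes> d [^] k \<otimes> inv b"
        using ab(1,2) dc by (simp add: m_assoc[symmetric]) (simp add: m_assoc)
      also have "\<dots> = ?comm a (b \<otimes> b) \<otimes> (b \<otimes> d [^] k \<otimes> inv b)"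
        using ab(1,2) dc by (simp add: m_assoc inv_mult_group)
      finally show ?thesis .
    qed
    also have "b \<otimes> d [^] k \<otimes> inv b = list_product (replicate k (b \<otimes> d \<otimes> inv b))"
      using conj_pow ab(2) dc by (simp add: list_product_replicate)
    finally have "d [^] Suc n = list_product (?comm a (b \<otimes> b) # replicate k (b \<otimes> d \<otimes> inv b))" by simp
    moreover have "set (?comm a (b \<otimes> b) # replicate k (b \<otimes> d \<otimes> inv b)) \<subseteq> D"
      using D_memI[OF ab(1), of "b \<otimes> b"] ab(2) D_conj[OF d ab(2)] by (auto simp: set_replicate_conv_if)
    ultimately show ?thesis
      using k by (intro exI[of _ "?comm a (b \<otimes> b) # replicate k (b \<otimes> d \<otimes> inv b)"]) auto
  qed
  have "derived G (carrier G) \<subseteq> list_product ` {xs. set xs \<subseteq> D \<and> length xs \<le> n * card D}"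
  proof
    fix x assume "x \<in> derived G (carrier G)"
    then obtain k where k: "x \<in> set_power G D k"
      using generate_eq_Union_set_power[OF D_carrier D_inv] unfolding derived_def D_def by blast
    have "\<exists>xs. set xs \<subseteq> D \<and> x = list_product xs"
      using k
    proof (induction k arbitrary: x)
      case (Suc k)
      then obtain a y where ay: "a \<in> D" "y \<in> set_power G D k" "x = a \<otimes> y"
        by (auto elim: set_mult_memE)
      then obtain ys where "set ys \<subseteq> D" "y = list_product ys" using Suc.IH by blast
      then show ?case using ay by (intro exI[of _ "a # ys"]) auto
    qed (auto intro!: exI[of _ "[]"])
    then obtain xs where xs: "set xs \<subseteq> D" "x = list_product xs" by blast
    then show "x \<in> list_product ` {xs. set xs \<subseteq> D \<and> length xs \<le> n * card D}"
      using list_product_shorten[OF D_carrier _ D_fin _ xs(1), of n] D_conj pow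
      by (metis (mono_tags, lifting) image_eqI mem_Collect_eq)
  qed
  then show ?thesis
    using finite_lists_length_le[OF D_fin] finite_subset by blast
qed

end

section \<open>The commensurated subgroup is open\<close>

lemma (in group) finite_mod_if_finite_image:
  assumes H: "subgroup H G" and A: "A \<subseteq> carrier G" "finite ((\<lambda>a. H #> a) ` A)"
  shows "finite_mod H A"
proof -
  obtain F where F: "F \<subseteq> A" "finite F" "(\<lambda>a. H #> a) ` A = (\<lambda>a. H #> a) ` F"
    using finite_subset_image[OF A(2) subset_refl] by blast
  have "a \<in> H <#> F" if a: "a \<in> A" for a
  proof -
    obtain f where f: "f \<in> F" "H #> a = H #> f" using a F(3) by blast
    have "a \<in> H #> f" using rcos_self[OF _ H, of a] a A(1) f(2) by auto
    then show ?thesis using f(1) by (auto simp: r_coset_def set_mult_def)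
  qed
  then have "A \<subseteq> H <#> F" by (rule subsetI)
  then show ?thesis using F(2) order_trans[OF F(1) A(1)] unfolding finite_mod_def by blast
qed

context commensurated_subgroup
begin

text \<open>\<open>G = M V\<close>, and \<open>V\<close> is commutative modulo
  \<open>H \<subseteq> M\<close>, so \<open>G / M\<close> is abelian and perfectness gives
  \<open>M = G\<close>. Thus countably many cosets of \<open>H\<close> cover
  \<open>G\<close>.\<close>

lemma openin_if_perfect:
  assumes "topologically_simple G T" "H \<noteq> {\<one>}" "compactly_presented TYPE('x) G T"
    and perfect: "derived G (carrier G) = carrier G"
  shows "openin T H"
proof -
  obtain M F V where M: "M \<lhd> G" and F: "countable F" "F \<subseteq> carrier G" "M \<subseteq> H <#> F"
    and HM: "H \<subseteq> M" and V: "V \<subseteq> U"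
    and central: "\<And>u v. u \<in> U \<Longrightarrow> v \<in> V \<Longrightarrow> comm u v \<in> H"
    and MV: "\<And>g. g \<in> carrier G \<Longrightarrow> \<exists>m\<in>M. \<exists>v\<in>V. g = m \<otimes> v"
  proof (rule central_modulo[OF assms(1-3)], goal_cases)
    case (1 M F V)
    then show thesis by (intro that[of M F V])
  qed
  interpret M: normal M G by (rule M)
  have "comm g g' \<in> M" if gg: "g \<in> carrier G" "g' \<in> carrier G" for g g'
  proof -
    obtain m v m' v' where mv: "m \<in> M" "v \<in> V" "g = m \<otimes> v" "m' \<in> M" "v' \<in> V" "g' = m' \<otimes> v'"
      using MV gg by metis
    have vU: "v \<in> U" "v' \<in> U" using mv V by auto
    \<comment> \<open>All five factors lie in \<open>M\<close>, the commutator of \<open>v\<close>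
      and \<open>v'\<close> because it lies in \<open>H\<close>.\<close>
    have "comm g g' = m \<otimes> (v \<otimes> m' \<otimes> inv v) \<otimes> comm v v' \<otimes> (v' \<otimes> inv m \<otimes> inv v') \<otimes> inv m'"
      using mv(1,4) vU unfolding mv(3,6) by (simp add: m_assoc inv_mult_group)
    moreover have "comm v v' \<in> M" using central[OF vU(1) mv(5)] HM by blast
    ultimately show ?thesis using mv(1,4) vU M.inv_op_closed2 by simp
  qed
  then have "derived_set G (carrier G) \<subseteq> M" by blast
  then have "carrier G \<subseteq> M"
    using generate_subgroup_incl[OF _ M.subgroup_axioms] perfect unfolding derived_def by blast
  then have "carrier G \<subseteq> H <#> F" using F(3) by (rule order_trans)
  moreover have "openin T (carrier G)" "carrier G \<noteq> {}" using openin_topspace[of T] one_closed by auto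
  ultimately show ?thesis
    using openin_if_countable_mod[OF subgroup_H closed_H F(1,2)] by blast
qed

text \<open>Schur's theorem in \<open>U / H\<close>: the image of \<open>V\<close> is central by
  hypothesis, and it has finite index because \<open>V\<close> is open and \<open>U\<close> compact.
  The derived group of \<open>U / H\<close> is the image of that of \<open>U\<close>.\<close>

lemma finite_mod_derived:
  assumes V: "subgroup V G" "V \<subseteq> U" "openin T V"
    and central: "\<And>u v. u \<in> U \<Longrightarrow> v \<in> V \<Longrightarrow> comm u v \<in> H"
  shows "finite_mod H (derived G U)"
proof -
  let ?G = "G\<lparr>carrier := U\<rparr>" and ?\<pi> = "\<lambda>u. H #> u"
  interpret GU: group ?G by (rule subgroup_imp_group[OF U.subgroup_axioms])
  interpret H: normal H ?G
  proof (rule GU.normal_invI)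
    show "subgroup H ?G" by (rule subgroup_incl[OF subgroup_H U.subgroup_axioms H_subset])
  qed (use H_conj m_inv_consistent[OF U.subgroup_axioms] in simp)
  let ?Q = "?G Mod H"
  interpret Q: group ?Q by (rule H.factorgroup_is_group)
  have coset [simp]: "H #>\<^bsub>?G\<^esub> u = H #> u" for u by (simp add: r_coset_def)
  have hom: "?\<pi> \<in> hom ?G ?Q" using H.r_coset_hom_Mod by simp
  interpret \<pi>: group_hom ?G ?Q ?\<pi>
    by unfold_locales (rule hom)
  have surj: "carrier ?Q = ?\<pi> ` U" by (simp add: carrier_FactGroup)
  have \<pi>_mult: "(H #> u) \<otimes>\<^bsub>?Q\<^esub> (H #> v) = H #> (u \<otimes> v)" if "u \<in> U" "v \<in> U" for u v
    using \<pi>.hom_mult[of u v] that by simp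
  have "finite (derived ?Q (carrier ?Q))"
  proof (rule Q.Schur_finite_derived)
    have "subgroup V ?G" by (rule subgroup_incl[OF V(1) U.subgroup_axioms V(2)])
    then show Z: "subgroup (?\<pi> ` V) ?Q" by (rule \<pi>.subgroup_img_is_subgroup)
    fix z g assume "z \<in> ?\<pi> ` V" "g \<in> carrier ?Q"
    then obtain v u where vu: "v \<in> V" "z = H #> v" "u \<in> U" "g = H #> u" by (auto simp: surj)
    have v: "v \<in> U" using vu(1) V(2) by blast
    have "u \<otimes> v = comm u v \<otimes> (v \<otimes> u)" using vu(3) v by (simp add: m_assoc)
    then have "H #> (u \<otimes> v) = (H #> comm u v) #> (v \<otimes> u)"
      using vu(3) v H.subset by (subst coset_mult_assoc) auto
    also have "H #> comm u v = H" using central[OF vu(3,1)] by (simp add: coset_join2 subgroup_H)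
    finally show "z \<otimes>\<^bsub>?Q\<^esub> g = g \<otimes>\<^bsub>?Q\<^esub> z"
      unfolding vu(2,4) using \<pi>_mult vu(3) v by simp
  next
    have Z: "?\<pi> ` V \<subseteq> carrier ?Q" using V(2) by (auto simp: surj)
    obtain F where F: "finite F" "F \<subseteq> U" "\<And>u. u \<in> U \<Longrightarrow> \<exists>c\<in>F. u \<otimes> inv c \<in> V"
      using finite_right_cover[OF compact_U V(3) subgroup.one_closed[OF V(1)]] by metis
    \<comment> \<open>From \<open>u = (u c^-1) c\<close> with \<open>u c^-1\<close> in
      \<open>V\<close>, the cosets of the finitely many \<open>c\<close> are all the cosets.\<close>
    have "rcosets\<^bsub>?Q\<^esub> (?\<pi> ` V) \<subseteq> (\<lambda>c. (?\<pi> ` V) #>\<^bsub>?Q\<^esub> (H #> c)) ` F"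
    proof
      fix C assume "C \<in> rcosets\<^bsub>?Q\<^esub> (?\<pi> ` V)"
      then obtain u where u: "u \<in> U" "C = (?\<pi> ` V) #>\<^bsub>?Q\<^esub> (H #> u)"
        by (auto simp: RCOSETS_def surj)
      obtain c where c: "c \<in> F" "u \<otimes> inv c \<in> V" using F(3)[OF u(1)] by blast
      have cU: "c \<in> U" using c(1) F(2) by blast
      have "H #> u = (H #> (u \<otimes> inv c)) \<otimes>\<^bsub>?Q\<^esub> (H #> c)"
        using \<pi>_mult[of "u \<otimes> inv c" c] u(1) cU by (simp add: m_assoc)
      then have "C = (?\<pi> ` V #>\<^bsub>?Q\<^esub> (H #> (u \<otimes> inv c))) #>\<^bsub>?Q\<^esub> (H #> c)"
        unfolding u(2) using Z u(1) cU c(2) by (subst Q.coset_mult_assoc) (auto simp: surj)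
      also have "?\<pi> ` V #>\<^bsub>?Q\<^esub> (H #> (u \<otimes> inv c)) = ?\<pi> ` V"
        using Z c(2) \<pi>.subgroup_img_is_subgroup[OF subgroup_incl[OF V(1) U.subgroup_axioms V(2)]]
        by (intro Q.coset_join2) auto
      finally show "C \<in> (\<lambda>c. (?\<pi> ` V) #>\<^bsub>?Q\<^esub> (H #> c)) ` F" using c(1) by blast
    qed
    then show "finite (rcosets\<^bsub>?Q\<^esub> (?\<pi> ` V))" using F(1) finite_subset by blast
  qed
  moreover have "derived ?Q (carrier ?Q) = ?\<pi> ` derived ?G U"
    using \<pi>.derived_img[of U] by (simp add: surj)
  moreover have "derived ?G U = derived G U"
    by (rule derived_consistent[OF subset_refl U.subgroup_axioms])
  ultimately have "finite (?\<pi> ` derived G U)" by simp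
  then show ?thesis
    by (intro finite_mod_if_finite_image[OF subgroup_H] derived_in_carrier U.subset)
qed

text \<open>Finitely many cosets of \<open>H\<close> cover \<open>derived G U\<close>. Their union
  is closed, so it also covers the closure, and since the closure has finite index in
  \<open>U\<close>, finitely many cosets of \<open>H\<close> cover \<open>U\<close>.\<close>

lemma openin_if_finite_abelianization:
  assumes "topologically_simple G T" "H \<noteq> {\<one>}" "compactly_presented TYPE('x) G T"
    and fin: "finite (carrier (G\<lparr>carrier := U\<rparr> Mod (T closure_of (derived G U))))"
  shows "openin T H"
proof -
  obtain V where V: "subgroup V G" "V \<subseteq> U" "openin T V" "\<And>u v. u \<in> U \<Longrightarrow> v \<in> V \<Longrightarrow> comm u v \<in> H"
  proof (rule central_modulo[OF assms(1-3)], goal_cases)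
    case (1 M F V)
    then show thesis by (intro that[of V])
  qed
  obtain F where F: "finite F" "F \<subseteq> carrier G" "derived G U \<subseteq> H <#> F"
    using finite_mod_derived[OF V] unfolding finite_mod_def by blast
  let ?C = "T closure_of (derived G U)"
  have "H <#> F = (\<Union>f\<in>F. H #> f)" by (auto simp: set_mult_def r_coset_def)
  then have "closedin T (H <#> F)"
    using F(1,2) closedin_translate[OF closed_H H.subset] by (auto intro!: closedin_Union)
  then have C: "?C \<subseteq> H <#> F" using F(3) by (simp add: closure_of_minimal)
  have "\<one> \<in> derived G U" using derived_is_subgroup[OF U.subset] subgroup.one_closed by blast
  then have one: "\<one> \<in> ?C"
    using closure_of_subset[of "derived G U" T] derived_in_carrier[OF U.subset] by auto
  have "finite ((\<lambda>u. ?C #> u) ` U)"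
    using fin by (simp add: carrier_FactGroup r_coset_def)
  then obtain E where E: "E \<subseteq> U" "finite E" "(\<lambda>u. ?C #> u) ` U = (\<lambda>u. ?C #> u) ` E"
    using finite_subset_image[of "(\<lambda>u. ?C #> u) ` U" "\<lambda>u. ?C #> u" U] by blast
  have "u \<in> H <#> (F <#> E)" if u: "u \<in> U" for u
  proof -
    obtain e where e: "e \<in> E" "?C #> u = ?C #> e" using u E(3) by blast
    have "\<one> \<otimes> u \<in> ?C #> u" using one unfolding r_coset_def by blast
    then obtain c where c: "c \<in> ?C" "u = c \<otimes> e" using e u by (auto simp: r_coset_def)
    then obtain h f where hf: "h \<in> H" "f \<in> F" "c = h \<otimes> f" using C by (blast elim: set_mult_memE)
    then have "u = h \<otimes> (f \<otimes> e)"
      using c(2) subsetD[OF F(2)] subsetD[OF E(1)] e(1) by (simp add: m_assoc)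
    then show ?thesis using hf e(1) by (simp add: set_mult_memI)
  qed
  moreover have "finite (F <#> E)" "F <#> E \<subseteq> carrier G"
    using F(1,2) E(1,2) U.subset by (auto simp: set_mult_def) 
  moreover have "U \<noteq> {}" using U.one_closed by blast
  ultimately show ?thesis
    using openin_if_countable_mod[OF subgroup_H closed_H _ _ open_U, of "F <#> E"]
    by (simp add: countable_finite subsetI)
qed

end

section \<open>The structure lattice\<close>

lemma conj_set_eq: "conj_set G g H = (\<lambda>h. g \<otimes>\<^bsub>G\<^esub> h \<otimes>\<^bsub>G\<^esub> inv\<^bsub>G\<^esub> g) ` H"
  by (auto simp: conj_set_def l_coset_def r_coset_def)

context group
begin

lemma conj_set_memI: "h \<in> H \<Longrightarrow> g \<otimes> h \<otimes> inv g \<in> conj_set G g H"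
  by (simp add: conj_set_eq)

lemma mem_conj_set_iff:
  assumes "H \<subseteq> carrier G" "g \<in> carrier G"
  shows "x \<in> conj_set G g H \<longleftrightarrow> x \<in> carrier G \<and> inv g \<otimes> x \<otimes> g \<in> H"
proof
  assume "x \<in> conj_set G g H"
  then obtain h where h: "h \<in> H" "x = g \<otimes> h \<otimes> inv g" by (auto simp: conj_set_eq)
  then show "x \<in> carrier G \<and> inv g \<otimes> x \<otimes> g \<in> H"
    using assms by (auto simp: m_assoc subset_iff)
next
  assume x: "x \<in> carrier G \<and> inv g \<otimes> x \<otimes> g \<in> H"
  then have "x = g \<otimes> (inv g \<otimes> x \<otimes> g) \<otimes> inv g" using assms by (simp add: m_assoc)
  then show "x \<in> conj_set G g H" using x conj_set_memI by metis
qed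

lemma conj_set_eqI:
  assumes "H \<subseteq> carrier G" "g \<in> carrier G"
  shows "conj_set G g H = {x \<in> carrier G. inv g \<otimes> x \<otimes> g \<in> H}"
  using mem_conj_set_iff[OF assms] by blast

lemma conj_set_subgroup:
  assumes H: "subgroup H G" and g: "g \<in> carrier G"
  shows "subgroup (conj_set G g H) G"
proof -
  interpret subgroup H G by fact
  show ?thesis unfolding conj_set_eqI[OF subset g]
  proof
    fix x y assume xy: "x \<in> {x \<in> carrier G. inv g \<otimes> x \<otimes> g \<in> H}" "y \<in> {x \<in> carrier G. inv g \<otimes> x \<otimes> g \<in> H}"
    have "inv g \<otimes> (x \<otimes> y) \<otimes> g = (inv g \<otimes> x \<otimes> g) \<otimes> (inv g \<otimes> y \<otimes> g)"
      using xy g by (simp add: m_assoc)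
    then show "x \<otimes> y \<in> {x \<in> carrier G. inv g \<otimes> x \<otimes> g \<in> H}" using xy by simp
  next
    fix x assume x: "x \<in> {x \<in> carrier G. inv g \<otimes> x \<otimes> g \<in> H}"
    have "inv g \<otimes> inv x \<otimes> g = inv (inv g \<otimes> x \<otimes> g)"
      using x g by (simp add: m_assoc inv_mult_group)
    then show "inv x \<in> {x \<in> carrier G. inv g \<otimes> x \<otimes> g \<in> H}" using x by simp
  qed (use g in auto)
qed

lemma mem_normalizer_iff:
  "H \<subseteq> carrier G \<Longrightarrow> g \<in> normalizer G H \<longleftrightarrow> g \<in> carrier G \<and> conj_set G g H = H"
  by (simp add: normalizer_def stabilizer_def conj_set_def)

lemma conj_set_mult:
  assumes "H \<subseteq> carrier G" "g \<in> carrier G" "h \<in> carrier G"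
  shows "conj_set G (g \<otimes> h) H = conj_set G g (conj_set G h H)"
  unfolding conj_set_eq image_image
  by (rule image_cong) (use assms in \<open>auto simp: m_assoc inv_mult_group subset_iff\<close>)

lemma conj_set_one: "H \<subseteq> carrier G \<Longrightarrow> conj_set G \<one> H = H"
  by (force simp: conj_set_eq)

lemma conj_set_subgroup_self:
  assumes "subgroup U G" "u \<in> U"
  shows "conj_set G u U = U"
proof -
  interpret subgroup U G by fact
  show ?thesis
  proof
    show "conj_set G u U \<subseteq> U" using assms(2) by (auto simp: conj_set_eq)
    show "U \<subseteq> conj_set G u U" using assms(2) by (auto simp: mem_conj_set_iff subset)
  qed
qed

end

section \<open>Local equivalence and the conjugation action on classes\<close>

context topological_group
begin

text \<open>For \<open>x\<close> in \<open>H \<inter> K\<close>, the translate \<open>x A\<close>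
  meets \<open>H\<close> only inside \<open>K\<close>; the union of these translates cuts
  \<open>H \<inter> K\<close> out of \<open>H\<close>.\<close>

lemma openin_subtopology_Int:
  assumes H: "subgroup H G" and K: "subgroup K G"
    and A: "openin T A" "\<one> \<in> A" "A \<inter> H \<subseteq> K"
  shows "openin (subtopology T H) (H \<inter> K)"
proof -
  interpret H: subgroup H G by fact
  interpret K: subgroup K G by fact
  let ?B = "\<Union>x\<in>H \<inter> K. {y \<in> carrier G. inv x \<otimes> y \<in> A}"
  have "openin T ?B"
    by (intro openin_Union ballI) (auto intro!: openin_preimage continuous_map_group_intros A(1))
  moreover have "H \<inter> K = ?B \<inter> H"
  proof (intro equalityI subsetI)
    fix y assume y: "y \<in> ?B \<inter> H"
    then obtain x where x: "x \<in> H" "x \<in> K" "inv x \<otimes> y \<in> A" by blast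
    have "inv x \<otimes> y \<in> K" using A(3) x y by auto
    then have "x \<otimes> (inv x \<otimes> y) \<in> K" using x(2) by simp
    then show "y \<in> H \<inter> K" using x y by simp
  next
    fix y assume y: "y \<in> H \<inter> K"
    then have "y \<in> {z \<in> carrier G. inv y \<otimes> z \<in> A}" using A(2) by simp
    then show "y \<in> ?B \<inter> H" using y by blast
  qed
  ultimately show ?thesis unfolding openin_subtopology by blast
qed

text \<open>Equivalence means having the same germ at the identity. In this form, transitivity and
  conjugation invariance reduce to intersecting and conjugating neighbourhoods.\<close>

lemma loc_equiv_iff:
  "(H, K) \<in> loc_equiv G T \<longleftrightarrow>
     H \<in> closed_locally_normal G T \<and> K \<in> closed_locally_normal G T \<and>
     (\<exists>A. openin T A \<and> \<one> \<in> A \<and> A \<inter> H = A \<inter> K)"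
proof (cases "H \<in> closed_locally_normal G T \<and> K \<in> closed_locally_normal G T")
  case True
  then have H: "subgroup H G" and K: "subgroup K G"
    by (simp_all add: closed_locally_normal_def locally_normal_def)
  have "(openin (subtopology T H) (H \<inter> K) \<and> openin (subtopology T K) (H \<inter> K)) \<longleftrightarrow>
      (\<exists>A. openin T A \<and> \<one> \<in> A \<and> A \<inter> H = A \<inter> K)" (is "?L \<longleftrightarrow> ?R")
  proof
    assume ?L
    then obtain A B where AB: "openin T A" "H \<inter> K = A \<inter> H" "openin T B" "H \<inter> K = B \<inter> K"
      unfolding openin_subtopology by blast
    have "\<one> \<in> H \<inter> K" using subgroup.one_closed[OF H] subgroup.one_closed[OF K] by blast
    then have "\<one> \<in> A \<inter> B" using AB(2,4) by blast
    moreover have "A \<inter> B \<inter> H = A \<inter> B \<inter> K" using AB(2,4) by blast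
    ultimately show ?R using AB(1,3) by blast
  next
    assume ?R
    then obtain A where A: "openin T A" "\<one> \<in> A" "A \<inter> H = A \<inter> K" by blast
    then have AHK: "A \<inter> H \<subseteq> K" "A \<inter> K \<subseteq> H" by blast+
    show ?L
      using openin_subtopology_Int[OF H K A(1,2) AHK(1)] openin_subtopology_Int[OF K H A(1,2) AHK(2)]
      by (simp add: Int_commute)
  qed
  then show ?thesis using True by (simp add: loc_equiv_def)
qed (auto simp: loc_equiv_def)

lemma loc_equiv_refl: "H \<in> closed_locally_normal G T \<Longrightarrow> (H, H) \<in> loc_equiv G T"
  unfolding loc_equiv_iff using openin_topspace[of T] by (metis one_closed topspace)

lemma loc_equiv_sym: "(H, K) \<in> loc_equiv G T \<Longrightarrow> (K, H) \<in> loc_equiv G T"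
  unfolding loc_equiv_iff by metis

lemma loc_equiv_trans:
  assumes "(H, K) \<in> loc_equiv G T" "(K, L) \<in> loc_equiv G T"
  shows "(H, L) \<in> loc_equiv G T"
proof -
  obtain A where A: "openin T A" "\<one> \<in> A" "A \<inter> H = A \<inter> K"
    using assms(1) unfolding loc_equiv_iff by blast
  obtain B where B: "openin T B" "\<one> \<in> B" "B \<inter> K = B \<inter> L"
    using assms(2) unfolding loc_equiv_iff by blast
  have "A \<inter> B \<inter> H = A \<inter> B \<inter> L" using A(3) B(3) by blast
  then have "\<exists>A. openin T A \<and> \<one> \<in> A \<and> A \<inter> H = A \<inter> L"
    using A B by (intro exI[of _ "A \<inter> B"]) auto
  then show ?thesis using assms unfolding loc_equiv_iff by blast
qed

lemma loc_equiv_class_eq: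
  "(H, K) \<in> loc_equiv G T \<Longrightarrow> loc_equiv G T `` {H} = loc_equiv G T `` {K}"
  using loc_equiv_trans loc_equiv_sym by blast

lemma closed_locally_normalI:
  assumes H: "subgroup H G" "closedin T H"
    and A: "openin T A" "\<one> \<in> A" "\<And>g. g \<in> A \<Longrightarrow> conj_set G g H = H"
  shows "H \<in> closed_locally_normal G T"
proof -
  have Hc: "H \<subseteq> carrier G" by (rule subgroup.subset[OF H(1)])
  have "A \<subseteq> normalizer G H"
    using A(3) openin_carrierD[OF A(1)] mem_normalizer_iff[OF Hc] by blast
  then have "openin T (normalizer G H)"
    by (rule openin_subgroupI[OF normalizer_imp_subgroup[OF Hc] A(1,2)])
  then show ?thesis using H by (simp add: closed_locally_normal_def locally_normal_def)
qed

lemma closed_locally_normalD: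
  assumes "H \<in> closed_locally_normal G T"
  shows "subgroup H G" "closedin T H" "openin T (normalizer G H)" "\<one> \<in> normalizer G H"
    "H \<subseteq> carrier G"
  using assms conj_set_one[of H] mem_normalizer_iff[of H \<one>]
  by (simp_all add: closed_locally_normal_def locally_normal_def subgroup.subset)

lemma openin_conj_preimage:
  assumes "g \<in> carrier G" "openin T A"
  shows "openin T {x \<in> carrier G. inv g \<otimes> x \<otimes> g \<in> A}"
  using assms by (intro openin_preimage continuous_map_group_intros) auto

text \<open>The \<open>g\<close>-conjugate of the open normaliser of \<open>H\<close> normalises
  \<open>gHg^-1\<close>.\<close>

lemma conj_set_closed_locally_normal:
  assumes H: "H \<in> closed_locally_normal G T" and g: "g \<in> carrier G"
  shows "conj_set G g H \<in> closed_locally_normal G T"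
proof -
  note HD = closed_locally_normalD[OF H]
  show ?thesis
  proof (rule closed_locally_normalI)
    show "subgroup (conj_set G g H) G" by (rule conj_set_subgroup[OF HD(1) g])
    show "closedin T (conj_set G g H)"
      unfolding conj_set_eqI[OF HD(5) g]
      using g HD(2) by (intro closedin_preimage continuous_map_group_intros) auto
    show "openin T {x \<in> carrier G. inv g \<otimes> x \<otimes> g \<in> normalizer G H}"
      by (rule openin_conj_preimage[OF g HD(3)])
    show "\<one> \<in> {x \<in> carrier G. inv g \<otimes> x \<otimes> g \<in> normalizer G H}" using g HD(4) by simp
    fix x assume "x \<in> {x \<in> carrier G. inv g \<otimes> x \<otimes> g \<in> normalizer G H}"
    then have x: "x \<in> carrier G" "conj_set G (inv g \<otimes> x \<otimes> g) H = H"
      using mem_normalizer_iff[OF HD(5)] by auto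
    have "conj_set G x (conj_set G g H) = conj_set G (g \<otimes> (inv g \<otimes> x \<otimes> g)) H"
      using x(1) g HD(5) by (simp add: conj_set_mult[symmetric] m_assoc)
    also have "\<dots> = conj_set G g (conj_set G (inv g \<otimes> x \<otimes> g) H)"
      using x(1) g HD(5) by (intro conj_set_mult) auto
    finally show "conj_set G x (conj_set G g H) = conj_set G g H" using x(2) by simp
  qed
qed

lemma conj_set_loc_equiv:
  assumes HK: "(H, K) \<in> loc_equiv G T" and g: "g \<in> carrier G"
  shows "(conj_set G g H, conj_set G g K) \<in> loc_equiv G T"
proof -
  have H: "H \<in> closed_locally_normal G T" and K: "K \<in> closed_locally_normal G T"
    using HK unfolding loc_equiv_iff by blast+
  obtain A where A: "openin T A" "\<one> \<in> A" "A \<inter> H = A \<inter> K"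
    using HK unfolding loc_equiv_iff by blast
  let ?A = "{x \<in> carrier G. inv g \<otimes> x \<otimes> g \<in> A}"
  have "?A \<inter> conj_set G g H = ?A \<inter> conj_set G g K"
    unfolding conj_set_eqI[OF closed_locally_normalD(5)[OF H] g]
      conj_set_eqI[OF closed_locally_normalD(5)[OF K] g] using A(3) by blast
  moreover have "\<one> \<in> ?A" using g A(2) by simp
  ultimately show ?thesis
    unfolding loc_equiv_iff
    using openin_conj_preimage[OF g A(1)] conj_set_closed_locally_normal[OF _ g] H K by blast
qed

text \<open>\<open>LN_action\<close> takes a union over all representatives; conjugation respects
  local equivalence, so all of them contribute the same class.\<close>

lemma LN_action_class:
  assumes H: "H \<in> closed_locally_normal G T" and g: "g \<in> carrier G"
  shows "LN_action G T g (loc_equiv G T `` {H}) = loc_equiv G T `` {conj_set G g H}"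
proof -
  have "loc_equiv G T `` {conj_set G g K} = loc_equiv G T `` {conj_set G g H}"
    if "K \<in> loc_equiv G T `` {H}" for K
    using loc_equiv_class_eq[OF conj_set_loc_equiv[OF _ g, of H K]] that by simp
  moreover have "H \<in> loc_equiv G T `` {H}" using loc_equiv_refl[OF H] by simp
  ultimately show ?thesis unfolding LN_action_def by blast
qed

end

section \<open>The fixed classes \<open>LN_zero\<close> and \<open>LN_infty\<close>, and
  representatives of fixed classes\<close>

context tdlc_group
begin

lemma compact_open_closed_locally_normal:
  assumes "compact_open_subgroup G T U"
  shows "U \<in> closed_locally_normal G T"
proof -
  have U: "subgroup U G" "compactin T U" "openin T U"
    using assms by (simp_all add: compact_open_subgroup_def)
  show ?thesis
    by (rule closed_locally_normalI[OF U(1) _ U(3)])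
      (use U compactin_imp_closedin[OF Hausdorff] subgroup.one_closed conj_set_subgroup_self in auto)
qed

lemma trivial_closed_locally_normal: "{\<one>} \<in> closed_locally_normal G T"
proof (rule closed_locally_normalI)
  show "closedin T {\<one>}" using Hausdorff by (simp add: compactin_imp_closedin)
  show "openin T (carrier G)" using openin_topspace[of T] by simp
qed (auto simp: triv_subgroup conj_set_eq)

text \<open>Two compact open subgroups agree on their intersection, an open neighbourhood of the
  identity, so the union defining \<open>LN_infty\<close> runs over copies of one class.\<close>

lemma LN_infty_eq:
  assumes U: "compact_open_subgroup G T U"
  shows "LN_infty G T = loc_equiv G T `` {U}"
proof -
  have "loc_equiv G T `` {V} = loc_equiv G T `` {U}" if V: "compact_open_subgroup G T V" for V
  proof (rule loc_equiv_class_eq)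
    have "openin T (V \<inter> U)" "\<one> \<in> V \<inter> U"
      using U V by (auto simp: compact_open_subgroup_def subgroup.one_closed)
    then show "(V, U) \<in> loc_equiv G T"
      unfolding loc_equiv_iff
      using compact_open_closed_locally_normal[OF U] compact_open_closed_locally_normal[OF V] by blast
  qed
  then show ?thesis using U unfolding LN_infty_def by blast
qed

lemma conj_set_compact_open:
  assumes U: "compact_open_subgroup G T U" and g: "g \<in> carrier G"
  shows "compact_open_subgroup G T (conj_set G g U)"
proof -
  have U': "subgroup U G" "compactin T U" "openin T U"
    using U by (simp_all add: compact_open_subgroup_def)
  have "compactin T (conj_set G g U)"
    unfolding conj_set_eq using g U'(2) by (intro compactin_image continuous_map_group_intros) auto
  moreover have "openin T (conj_set G g U)"
    unfolding conj_set_eqI[OF subgroup.subset[OF U'(1)] g] by (rule openin_conj_preimage[OF g U'(3)])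
  ultimately show ?thesis
    using conj_set_subgroup[OF U'(1) g] by (simp add: compact_open_subgroup_def)
qed

lemma LN_zero_fixed: "LN_zero G T \<in> LN_fixed G T"
proof -
  have "LN_action G T g (LN_zero G T) = LN_zero G T" if "g \<in> carrier G" for g
    using LN_action_class[OF trivial_closed_locally_normal that] that
    by (simp add: LN_zero_def conj_set_eq)
  moreover have "LN_zero G T \<in> structure_lattice G T"
    unfolding LN_zero_def structure_lattice_def by (rule quotientI[OF trivial_closed_locally_normal])
  ultimately show ?thesis by (simp add: LN_fixed_def)
qed

lemma LN_infty_fixed: "LN_infty G T \<in> LN_fixed G T"
proof -
  obtain U where U: "compact_open_subgroup G T U" using compact_open_subgroup_exists by blast
  have "LN_action G T g (LN_infty G T) = LN_infty G T" if "g \<in> carrier G" for g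
    using LN_action_class[OF compact_open_closed_locally_normal[OF U] that]
      LN_infty_eq[OF U] LN_infty_eq[OF conj_set_compact_open[OF U that]] by simp
  moreover have "LN_infty G T \<in> structure_lattice G T"
    unfolding LN_infty_eq[OF U] structure_lattice_def
    by (rule quotientI[OF compact_open_closed_locally_normal[OF U]])
  ultimately show ?thesis by (simp add: LN_fixed_def)
qed

lemma LN_fixed_loc_equiv:
  assumes "c \<in> LN_fixed G T" "H \<in> c" "g \<in> carrier G"
  shows "H \<in> closed_locally_normal G T" "c = loc_equiv G T `` {H}" "(H, conj_set G g H) \<in> loc_equiv G T"
proof -
  obtain K where "c = loc_equiv G T `` {K}"
    using assms(1) unfolding LN_fixed_def structure_lattice_def by (blast elim: quotientE)
  then show c: "c = loc_equiv G T `` {H}" using assms(2) loc_equiv_class_eq by blast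
  then show H: "H \<in> closed_locally_normal G T" using assms(2) by (auto simp: loc_equiv_iff)
  have "loc_equiv G T `` {conj_set G g H} = c"
    using assms(1,3) LN_action_class[OF H assms(3)] unfolding LN_fixed_def c by blast
  then show "(H, conj_set G g H) \<in> loc_equiv G T"
    using loc_equiv_refl[OF conj_set_closed_locally_normal[OF H assms(3)]] c by blast
qed

text \<open>The normal core in \<open>U\<close> of a representative \<open>K\<close> is an intersection of finitely many
  conjugates of \<open>K\<close>, since the normaliser of \<open>K\<close> is open and \<open>U\<close> is compact.\<close>

lemma LN_fixed_representative:
  assumes c: "c \<in> LN_fixed G T" and U: "compact_open_subgroup G T U"
  obtains H where "H \<in> c" "commensurated_subgroup G T U H"
proof -
  have U': "compactin T U" "openin T U" using U by (simp_all add: compact_open_subgroup_def)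
  interpret U: subgroup U G using U by (simp add: compact_open_subgroup_def)
  obtain K where "K \<in> closed_locally_normal G T" "c = loc_equiv G T `` {K}"
    using c unfolding LN_fixed_def structure_lattice_def by (blast elim: quotientE)
  then have Kc: "K \<in> c" and K: "K \<in> closed_locally_normal G T" using loc_equiv_refl by auto
  note KD = closed_locally_normalD[OF K]
  interpret K: subgroup K G by (rule KD(1))
  \<comment> \<open>The intersection of \<open>U\<close> with all the conjugates
    \<open>u K u^-1\<close> for \<open>u\<close> in \<open>U\<close>, hence normalised by
    \<open>U\<close>.\<close>
  define H where "H = {x \<in> U. \<forall>u\<in>U. inv u \<otimes> x \<otimes> u \<in> K}"
  have H_sub: "subgroup H G"
  proof
    fix x y assume xy: "x \<in> H" "y \<in> H"
    then have xyU: "x \<in> U" "y \<in> U" by (simp_all add: H_def)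
    have "inv u \<otimes> (x \<otimes> y) \<otimes> u \<in> K" if u: "u \<in> U" for u
    proof -
      have "inv u \<otimes> (x \<otimes> y) \<otimes> u = (inv u \<otimes> x \<otimes> u) \<otimes> (inv u \<otimes> y \<otimes> u)"
        using xyU u by (simp add: m_assoc)
      then show ?thesis using xy u by (simp add: H_def)
    qed
    then show "x \<otimes> y \<in> H" using xyU by (simp add: H_def)
  next
    fix x assume x: "x \<in> H"
    then have xU: "x \<in> U" by (simp add: H_def)
    have "inv u \<otimes> inv x \<otimes> u \<in> K" if u: "u \<in> U" for u
    proof -
      have "inv u \<otimes> inv x \<otimes> u = inv (inv u \<otimes> x \<otimes> u)"
        using xU u by (simp add: m_assoc inv_mult_group)
      then show ?thesis using x u by (simp add: H_def)
    qed
    then show "inv x \<in> H" using xU by (simp add: H_def)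
  qed (auto simp: H_def)
  have H_conj: "u \<otimes> h \<otimes> inv u \<in> H" if u: "u \<in> U" and h: "h \<in> H" for u h
  proof -
    have hU: "h \<in> U" using h by (simp add: H_def)
    have "inv v \<otimes> (u \<otimes> h \<otimes> inv u) \<otimes> v \<in> K" if v: "v \<in> U" for v
    proof -
      have "inv v \<otimes> (u \<otimes> h \<otimes> inv u) \<otimes> v = inv (inv u \<otimes> v) \<otimes> h \<otimes> (inv u \<otimes> v)"
        using u v hU by (simp add: m_assoc inv_mult_group)
      then show ?thesis using h u v by (simp add: H_def)
    qed
    then show ?thesis using u hU by (simp add: H_def)
  qed
  have "closedin T U" by (rule compactin_imp_closedin[OF Hausdorff U'(1)])
  moreover have "closedin T {x \<in> carrier G. inv u \<otimes> x \<otimes> u \<in> K}" if "u \<in> U" for u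
    using that KD(2) by (intro closedin_preimage continuous_map_group_intros) auto
  moreover have "U \<noteq> {}" using U.one_closed by blast
  moreover from this have "H = (\<Inter>u\<in>U. U \<inter> {x \<in> carrier G. inv u \<otimes> x \<otimes> u \<in> K})"
    by (auto simp: H_def)
  ultimately have H_closed: "closedin T H"
    by (auto intro!: closedin_Inter)
  have H_ln: "H \<in> closed_locally_normal G T"
  proof (rule closed_locally_normalI[OF H_sub H_closed U'(2) U.one_closed])
    fix u assume u: "u \<in> U"
    have "x \<in> conj_set G u H" if x: "x \<in> H" for x
    proof -
      have "inv u \<otimes> x \<otimes> u \<in> H" using H_conj[of "inv u" x] u x by simp
      moreover have "x \<in> carrier G" using x by (simp add: H_def)
      ultimately show ?thesis using mem_conj_set_iff[OF subgroup.subset[OF H_sub], of u x] u by simp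
    qed
    then show "conj_set G u H = H" using H_conj[OF u] by (auto simp: conj_set_eq)
  qed
  obtain F where F: "finite F" "F \<subseteq> U" "\<And>u. u \<in> U \<Longrightarrow> \<exists>d\<in>F. inv d \<otimes> u \<in> normalizer G K"
    using finite_left_cover[OF U'(1) KD(3,4)] by metis
  have "\<exists>A. openin T A \<and> \<one> \<in> A \<and> A \<inter> K = A \<inter> conj_set G d K" if "d \<in> F" for d
    using LN_fixed_loc_equiv(3)[OF c Kc U.mem_carrier[OF subsetD[OF F(2) that]]]
    unfolding loc_equiv_iff by (elim conjE)
  then obtain A where A: "\<And>d. d \<in> F \<Longrightarrow> openin T (A d) \<and> \<one> \<in> A d \<and> A d \<inter> K = A d \<inter> conj_set G d K"
    by metis
  \<comment> \<open>Elements of \<open>K\<close> in this neighbourhood lie in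
    \<open>d K d^-1\<close> for every \<open>d\<close> in \<open>F\<close>. Every
    \<open>u K u^-1\<close> is one of these, as \<open>inv d \<otimes> u\<close> normalises
    \<open>K\<close> for some \<open>d\<close>; so these elements lie in \<open>H\<close>.\<close>
  let ?A = "U \<inter> \<Inter>(A ` F)"
  have "F \<noteq> {}" using F(3)[OF U.one_closed] by blast
  then have "openin T ?A" using A F(1) U'(2) by (intro openin_Int openin_Inter) auto
  moreover have "\<one> \<in> ?A" using A by auto
  moreover have "?A \<inter> K = ?A \<inter> H"
  proof (intro equalityI subsetI)
    fix x assume x: "x \<in> ?A \<inter> K"
    have "inv u \<otimes> x \<otimes> u \<in> K" if u: "u \<in> U" for u
    proof -
      obtain d where d: "d \<in> F" "inv d \<otimes> u \<in> normalizer G K" using F(3)[OF u] by blast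
      have dU: "d \<in> U" using d(1) F(2) by blast
      have "x \<in> conj_set G d K" using A[OF d(1)] x d(1) by blast
      then have xd: "inv d \<otimes> x \<otimes> d \<in> K" using mem_conj_set_iff[OF KD(5), of d x] dU by simp
      have "conj_set G (inv d \<otimes> u) K = K" using d(2) mem_normalizer_iff[OF KD(5)] by blast
      then have "inv (inv d \<otimes> u) \<otimes> (inv d \<otimes> x \<otimes> d) \<otimes> (inv d \<otimes> u) \<in> K"
        using xd mem_conj_set_iff[OF KD(5), of "inv d \<otimes> u" "inv d \<otimes> x \<otimes> d"] dU u by simp
      then show ?thesis using dU u x by (simp add: m_assoc inv_mult_group)
    qed
    then show "x \<in> ?A \<inter> H" using x by (simp add: H_def)
  next
    fix x assume x: "x \<in> ?A \<inter> H"
    then have "inv \<one> \<otimes> x \<otimes> \<one> \<in> K" unfolding H_def using U.one_closed by blast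
    then show "x \<in> ?A \<inter> K" using x by (simp add: H_def)
  qed
  ultimately have "(K, H) \<in> loc_equiv G T" unfolding loc_equiv_iff using K H_ln by blast
  then have Hc: "H \<in> c" using LN_fixed_loc_equiv(2)[OF c Kc one_closed] by blast
  have "commensurated_subgroup G T U H"
  proof (intro commensurated_subgroup.intro commensurated_subgroup_axioms.intro)
    show "tdlc_group G T" by unfold_locales
    show "H \<subseteq> U" by (auto simp: H_def)
    show "\<exists>A. openin T A \<and> \<one> \<in> A \<and> A \<inter> conj_set G g H \<subseteq> H" if "g \<in> carrier G" for g
      using LN_fixed_loc_equiv(3)[OF c Hc that] unfolding loc_equiv_iff by blast
  qed (fact U H_sub H_closed H_conj)+
  then show thesis using that Hc by blast
qed

end

theorem corollary5p18:
  fixes G :: "('a, 'b) monoid_scheme" and T :: "'a topology"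
  assumes "class_S G T"
    and "compactly_presented TYPE('x) G T"
    and "derived G (carrier G) = carrier G \<or>
      (\<exists>U. compact_open_subgroup G T U \<and>
         finite (carrier (G\<lparr>carrier := U\<rparr> Mod (T closure_of (derived G U)))))"
  shows "LN_fixed G T = {LN_zero G T, LN_infty G T}"
proof -
  have simple: "topologically_simple G T" and "tdlc_group G T"
    using assms(1) by (simp_all add: class_S_def)
  interpret tdlc_group G T by fact
  \<comment> \<open>In the perfect case \<open>U\<close> is supplied by van Dantzig's theorem;
    otherwise it is the subgroup from the hypothesis.\<close>
  obtain U where U: "compact_open_subgroup G T U"
    and alt: "derived G (carrier G) = carrier G \<or>
      finite (carrier (G\<lparr>carrier := U\<rparr> Mod (T closure_of (derived G U))))"
    using assms(3) compact_open_subgroup_exists by blast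
  have "c = LN_zero G T \<or> c = LN_infty G T" if c: "c \<in> LN_fixed G T" for c
  proof -
    obtain H where Hc: "H \<in> c" and "commensurated_subgroup G T U H"
      using LN_fixed_representative[OF c U] by blast
    interpret commensurated_subgroup G T U H by fact
    note c_eq = LN_fixed_loc_equiv(2)[OF c Hc one_closed]
    show ?thesis
    proof (cases "H = {\<one>\<^bsub>G\<^esub>}")
      case True
      then show ?thesis using c_eq by (simp add: LN_zero_def)
    next
      case False
      have "openin T H"
        using alt openin_if_perfect[OF simple False assms(2)]
          openin_if_finite_abelianization[OF simple False assms(2)] by blast
      \<comment> \<open>A closed subgroup of the compact \<open>U\<close> is compact, so an open
        \<open>H\<close> represents \<open>LN_infty\<close>.\<close>
      moreover have "compactin T H" by (rule closed_compactin[OF compact_U H_subset closed_H])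
      ultimately have "compact_open_subgroup G T H"
        using subgroup_H by (simp add: compact_open_subgroup_def)
      then show ?thesis using c_eq LN_infty_eq by simp
    qed
  qed
  then show ?thesis using LN_zero_fixed LN_infty_fixed by blast
qed

end
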